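(* Let $X_n=(\mathbb{C}^n,\|\cdot\|)$ be a Banach lattice and let $J\subset\mathbb{N}_0^n$ be an index set of degree at most $m$. Then $$\boldsymbol{\chi_{\mathrm{mon}}}\big(\mathcal{P}_J(X_n)\big)\le e(m+1)2^m\max_{1\le k\le m}\|\mathbf{Q}_{\Lambda(k,n),J(k)}\|\,\max_{1\le k\le m}\boldsymbol{\lambda}\big(\mathcal{P}_{J(k)^\flat}(X_n)\big).$$ In addition, if $J\subset\Lambda(m,n)$, then $$\boldsymbol{\chi_{\mathrm{mon}}}\big(\mathcal{P}_J(X_n)\big)\le e2^m\|\mathbf{Q}_{\Lambda(m,n),J}\|\,\boldsymbol{\lambda}\big(\mathcal{P}_{J^\flat}(X_n)\big).$$
   Context: A Banach lattice $X_n=(\mathbb{C}^n,\|\cdot\|)$ is a norm on $\mathbb{C}^n$ with $\|z\|\le\|w\|$ whenever $|z_k|\le|w_k|$ for all $k$. $\Lambda(k,n)=\{\alpha\in\mathbb{N}_0^n:|\alpha|=k\}$; $J(k)=J\cap\Lambda(k,n)$; $J$ has degree at most $m$ if $|\alpha|\le m$ for all $\alpha\in J$. For $J\subset\Lambda(m,n)$, $J^\flat=\{\alpha\in\Lambda(m-1,n):\alpha+e_k\in J\text{ for some }k\}$. $\mathcal{P}_J(X_n)$: polynomials $\sum_{\alpha\in J}c_\alpha z^\alpha$ with sup norm over the open unit ball of $X_n$. For $I\subset J'$, $\mathbf{Q}_{J',I}:\mathcal{P}_{J'}(X_n)\to\mathcal{P}_I(X_n)$ keeps the coefficients indexed by $I$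 and annihilates the others. $\boldsymbol{\lambda}$: projection constant. $\boldsymbol{\chi_{\mathrm{mon}}}(\mathcal{P}_J(X_n))$: least $K$ with $\|\sum\varepsilon_\alpha c_\alpha z^\alpha\|\le K\|\sum c_\alpha z^\alpha\|$ for all scalars and all $|\varepsilon_\alpha|=1$.
   Formalization: Assumes m ≥ 1 and that J contains some index of degree at least 1; for J = {0} the stated bound fails, since the left side is 1 and the right side is 0, and for m = 0 the maxima and J^♭ are undefined. *)

theory Defs
  imports "HOL-Analysis.Analysis"
begin

text \<open>Points of \<open>\<complex>^n\<close> are functions \<open>'n \<Rightarrow> complex\<close> for a finite index type \<open>'n\<close>
  (with \<open>n = CARD('n)\<close>); multi-indices in \<open>\<nat>\<^sub>0^n\<close> are functions \<open>'n \<Rightarrow> nat\<close>.\<close>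

definition banach_lattice_norm :: "(('n::finite \<Rightarrow> complex) \<Rightarrow> real) \<Rightarrow> bool" where
  "banach_lattice_norm N \<longleftrightarrow>
     (\<forall>z. 0 \<le> N z) \<and> (\<forall>z. N z = 0 \<longleftrightarrow> z = (\<lambda>_. 0)) \<and>
     (\<forall>a z. N (\<lambda>i. a * z i) = cmod a * N z) \<and>
     (\<forall>z w. N (\<lambda>i. z i + w i) \<le> N z + N w) \<and>
     (\<forall>z w. (\<forall>i. cmod (z i) \<le> cmod (w i)) \<longrightarrow> N z \<le> N w)"

definition unit_ball :: "(('n::finite \<Rightarrow> complex) \<Rightarrow> real) \<Rightarrow> ('n \<Rightarrow> complex) set" where
  "unit_ball N = {z. N z < 1}"

definition deg :: "('n::finite \<Rightarrow> nat) \<Rightarrow> nat" where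
  "deg \<alpha> = (\<Sum>i\<in>UNIV. \<alpha> i)"

definition Lambda :: "nat \<Rightarrow> ('n::finite \<Rightarrow> nat) set" where
  "Lambda k = {\<alpha>. deg \<alpha> = k}"

definition unitvec :: "'n \<Rightarrow> ('n \<Rightarrow> nat)" where
  "unitvec k = (\<lambda>j. if j = k then 1 else 0)"

definition flat :: "nat \<Rightarrow> ('n::finite \<Rightarrow> nat) set \<Rightarrow> ('n \<Rightarrow> nat) set" where
  "flat m J = {\<alpha> \<in> Lambda (m - 1). \<exists>k. (\<lambda>j. \<alpha> j + unitvec k j) \<in> J}"

definition mpoly_eval :: "('n::finite \<Rightarrow> nat) set \<Rightarrow> (('n \<Rightarrow> nat) \<Rightarrow> complex) \<Rightarrow> ('n \<Rightarrow> complex) \<Rightarrow> complex" where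
  "mpoly_eval I c z = (\<Sum>\<alpha>\<in>I. c \<alpha> * (\<Prod>i\<in>UNIV. z i ^ \<alpha> i))"

definition psup :: "(('n::finite \<Rightarrow> complex) \<Rightarrow> real) \<Rightarrow> ('n \<Rightarrow> nat) set \<Rightarrow> (('n \<Rightarrow> nat) \<Rightarrow> complex) \<Rightarrow> real" where
  "psup N I c = (SUP z\<in>unit_ball N. cmod (mpoly_eval I c z))"

definition chi_mon :: "(('n::finite \<Rightarrow> complex) \<Rightarrow> real) \<Rightarrow> ('n \<Rightarrow> nat) set \<Rightarrow> real" where
  "chi_mon N J = Inf {K. 0 \<le> K \<and>
     (\<forall>c \<epsilon>. (\<forall>\<alpha>. cmod (\<epsilon> \<alpha>) = 1) \<longrightarrow> psup N J (\<lambda>\<alpha>. \<epsilon> \<alpha> * c \<alpha>) \<le> K * psup N J c)}"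

definition qnorm :: "(('n::finite \<Rightarrow> complex) \<Rightarrow> real) \<Rightarrow> ('n \<Rightarrow> nat) set \<Rightarrow> ('n \<Rightarrow> nat) set \<Rightarrow> real" where
  "qnorm N A I = Inf {K. 0 \<le> K \<and> (\<forall>c. psup N I c \<le> K * psup N A c)}"

text \<open>Projection constant.  \<open>\<P>_I(X_n)\<close> is realised isometrically (by its very norm) as the
  subspace of polynomial functions inside \<open>\<ell>_\<infinity>(B)\<close>, \<open>B\<close> the open unit ball of \<open>X_n\<close>;
  \<open>\<ell>_\<infinity>(B)\<close> is represented by bounded functions vanishing off \<open>B\<close>.  Since \<open>\<ell>_\<infinity>(B)\<close> is
  injective, \<open>\<lambda>(\<P>_I(X_n))\<close> is the relative projection constant of this subspace.\<close>
definition linf_ball :: "(('n::finite \<Rightarrow> complex) \<Rightarrow> real) \<Rightarrow> (('n \<Rightarrow> complex) \<Rightarrow> complex) set" where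
  "linf_ball N = {f. bdd_above ((\<lambda>z. cmod (f z)) ` unit_ball N) \<and> (\<forall>z. z \<notin> unit_ball N \<longrightarrow> f z = 0)}"

definition supnorm :: "(('n::finite \<Rightarrow> complex) \<Rightarrow> real) \<Rightarrow> (('n \<Rightarrow> complex) \<Rightarrow> complex) \<Rightarrow> real" where
  "supnorm N f = (SUP z\<in>unit_ball N. cmod (f z))"

definition polyfuns :: "(('n::finite \<Rightarrow> complex) \<Rightarrow> real) \<Rightarrow> ('n \<Rightarrow> nat) set \<Rightarrow> (('n \<Rightarrow> complex) \<Rightarrow> complex) set" where
  "polyfuns N I = {f. \<exists>c. \<forall>z. f z = (if z \<in> unit_ball N then mpoly_eval I c z else 0)}"

definition is_projection_onto ::
  "(('n::finite \<Rightarrow> complex) \<Rightarrow> real) \<Rightarrow> ('n \<Rightarrow> nat) set \<Rightarrow>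
   ((('n \<Rightarrow> complex) \<Rightarrow> complex) \<Rightarrow> (('n \<Rightarrow> complex) \<Rightarrow> complex)) \<Rightarrow> bool" where
  "is_projection_onto N I P \<longleftrightarrow>
     (\<forall>f\<in>linf_ball N. P f \<in> polyfuns N I) \<and>
     (\<forall>f\<in>linf_ball N. \<forall>g\<in>linf_ball N. P (\<lambda>z. f z + g z) = (\<lambda>z. P f z + P g z)) \<and>
     (\<forall>f\<in>linf_ball N. \<forall>a::complex. P (\<lambda>z. a * f z) = (\<lambda>z. a * P f z)) \<and>
     (\<forall>f\<in>polyfuns N I. P f = f)"

definition proj_const :: "(('n::finite \<Rightarrow> complex) \<Rightarrow> real) \<Rightarrow> ('n \<Rightarrow> nat) set \<Rightarrow> real" where
  "proj_const N I = Inf {K. 0 \<le> K \<and> (\<exists>P. is_projection_onto N I P \<and>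
       (\<forall>f\<in>linf_ball N. supnorm N (P f) \<le> K * supnorm N f))}"

end

theory Submission
  imports Defs "HOL-Complex_Analysis.Complex_Analysis"
begin

text \<open>
  Let \<open>f = \<Sum>\<^sub>\<alpha> c\<^sub>\<alpha> z\<^sup>\<alpha>\<close> be \<open>m\<close>-homogeneous with exponents in \<open>J\<close>, and let \<open>x\<close> be a nonnegative point of
  the ball. The gradient of \<open>f\<close> maps into the lattice of bounded functions on the ball with values
  in the dual of \<open>X\<^sub>n\<close>, with norm at most \<open>e m \<parallel>f\<parallel>\<close> by a Cauchy estimate, and its components are
  polynomials with exponents in \<open>J\<^sup>\<flat>\<close>. A projection \<open>P\<close> of \<open>\<ell>\<^sub>\<infinity>\<close> of the ball onto these polynomials
  recovers the coefficients of \<open>f\<close> from the gradient through the functionals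
  \<open>\<psi>\<^sub>\<beta>(h) = [\<beta>-th coefficient of P h] x\<^sup>\<beta>\<close>. By the Cauchy--Schwarz inequality in \<open>\<beta>\<close>, the sum
  \<open>\<Sum>\<^sub>\<alpha> |c\<^sub>\<alpha>| x\<^sup>\<alpha>\<close> is bounded by the product of the square functions of the gradient and of the \<open>\<psi>\<^sub>\<beta>\<close>.
  Each square function is at most \<open>2\<^bsup>(m-1)/2\<^esup>\<close> times a mean over the torus, because the \<open>L\<^sub>2\<close>-norm of
  a homogeneous polynomial of degree \<open>d\<close> on the torus is at most \<open>2\<^bsup>d/2\<^esup>\<close> times its \<open>L\<^sub>1\<close>-norm. In one
  variable this is Carleman's inequality \<open>\<Sum>\<^sub>j |a\<^sub>j|\<^sup>2/(j+1) \<le> \<parallel>p\<parallel>\<^sub>1\<^sup>2\<close>, which follows from \<open>p = h\<^sup>2\<close> for \<open>p\<close>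
  without zeros in the disc, and Minkowski's inequality passes to several variables.

  Torus means are taken over \<open>M\<close>-th roots of unity; this costs a factor tending to 1 as \<open>M\<close> grows,
  which the spare factor 2 between \<open>2\<^bsup>m-1\<^esup>\<close> and \<open>2\<^sup>m\<close> absorbs. Since the evaluation at \<open>x\<close> is defined
  on all polynomials, only \<open>1 \<le> \<parallel>Q\<parallel>\<close> is needed about the coefficient projections.
\<close>

section \<open>Means over roots of unity\<close>

definition uroots :: "nat \<Rightarrow> complex set" where
  "uroots M = {z. z ^ M = 1}"

text \<open>A finite average in place of the normalized integral over the circle. The codomain is
  generic so that the same mean serves complex coefficients and real moduli.\<close>

definition umean :: "nat \<Rightarrow> (complex \<Rightarrow> 'a::real_normed_field) \<Rightarrow> 'a" where
  "umean M f = (\<Sum>w\<in>uroots M. f w) / of_nat M"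

lemma finite_uroots: "0 < M \<Longrightarrow> finite (uroots M)"
  unfolding uroots_def by (rule finite_roots_unity) simp

lemma card_uroots: "0 < M \<Longrightarrow> card (uroots M) = M"
  unfolding uroots_def by (rule card_roots_unity_eq)

lemma norm_uroots:
  assumes "0 < M" "w \<in> uroots M"
  shows "cmod w = 1"
proof -
  have "cmod w ^ M = 1 ^ M" using assms by (simp add: uroots_def norm_power[symmetric])
  then show ?thesis using power_eq_imp_eq_base[of "cmod w" M 1] assms(1) by simp
qed

lemma uroots_cnj_mult: "0 < M \<Longrightarrow> w \<in> uroots M \<Longrightarrow> w * cnj w = 1"
  using norm_uroots[of M w] by (simp add: complex_norm_square[symmetric])

lemma umean_cis: "0 < M \<Longrightarrow> umean M f = (\<Sum>l<M. f (cis (2 * pi * real l / real M))) / of_nat M"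
  unfolding umean_def uroots_def
  using sum.reindex_bij_betw[OF Complex.bij_betw_roots_unity[of M], of f] by simp

lemma umean_add: "umean M (\<lambda>w. f w + g w) = umean M f + umean M g"
  by (simp add: umean_def sum.distrib add_divide_distrib)

lemma umean_cmult: "umean M (\<lambda>w. c * f w) = c * umean M f"
  by (simp add: umean_def sum_distrib_left)

lemma umean_sum: "umean M (\<lambda>w. \<Sum>i\<in>I. f i w) = (\<Sum>i\<in>I. umean M (f i))"
  unfolding umean_def by (subst sum.swap) (simp add: sum_divide_distrib)

lemma umean_const: "0 < M \<Longrightarrow> umean M (\<lambda>w. c) = c"
  by (simp add: umean_def card_uroots)

lemma umean_mono:
  fixes f g :: "complex \<Rightarrow> real"
  shows "(\<And>w. w \<in> uroots M \<Longrightarrow> f w \<le> g w) \<Longrightarrow> umean M f \<le> umean M g"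
  unfolding umean_def by (intro divide_right_mono sum_mono) auto

lemma umean_cong: "(\<And>w. w \<in> uroots M \<Longrightarrow> f w = g w) \<Longrightarrow> umean M f = umean M g"
  unfolding umean_def by (intro arg_cong2[of _ _ _ _ "(/)"] sum.cong) auto

lemma norm_umean_le: "norm (umean M f) \<le> umean M (\<lambda>w. norm (f w))"
  unfolding umean_def norm_divide by (auto intro!: divide_right_mono norm_sum)

text \<open>Rotation invariance: multiplication by a primitive root \<open>\<omega>\<close> permutes
  the roots and multiplies the sum by \<open>\<omega> ^ i * cnj \<omega> ^ j\<close>, which differs
  from 1 unless the exponents agree.\<close>

lemma umean_orthogonal:
  assumes "i < M" "j < M"
  shows "umean M (\<lambda>w. w ^ i * cnj w ^ j) = (if i = j then 1 else 0)"
proof -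
  have M: "0 < M" using assms by simp
  show ?thesis
  proof (cases "i = j")
    case True
    have "umean M (\<lambda>w. w ^ i * cnj w ^ j) = umean M (\<lambda>w. 1 :: complex)"
      by (rule umean_cong) (use M True in \<open>simp add: power_mult_distrib[symmetric] uroots_cnj_mult\<close>)
    then show ?thesis using True M by (simp add: umean_const)
  next
    case False
    define \<omega> where "\<omega> = cis (2 * pi / real M)"
    have pw: "\<omega> ^ l = cis (2 * pi * real l / real M)" for l
      unfolding \<omega>_def Complex.DeMoivre by (simp add: mult_ac)
    have \<omega>M: "\<omega> \<in> uroots M"
      using M pw[of M] by (simp add: uroots_def)
    have cn: "\<omega> * cnj \<omega> = 1" using uroots_cnj_mult[OF M \<omega>M] .
    \<comment> \<open>This is where both exponents must lie below \<open>M\<close>: the first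
      \<open>M\<close> powers of \<open>\<omega>\<close> are distinct.\<close>
    have ne: "\<omega> ^ i \<noteq> \<omega> ^ j"
      using bij_betw_imp_inj_on[OF Complex.bij_betw_roots_unity[OF M]] assms False
      unfolding inj_on_def pw by blast
    have bij: "bij_betw (\<lambda>w. \<omega> * w) (uroots M) (uroots M)"
    proof (rule bij_betw_byWitness[where f' = "\<lambda>w. cnj \<omega> * w"])
      have "\<omega> ^ M = 1" using \<omega>M by (simp add: uroots_def)
      moreover have "cnj \<omega> ^ M = 1" using calculation by (metis complex_cnj_one complex_cnj_power)
      ultimately show "(\<lambda>w. \<omega> * w) ` uroots M \<subseteq> uroots M" "(\<lambda>w. cnj \<omega> * w) ` uroots M \<subseteq> uroots M"
        by (auto simp: uroots_def power_mult_distrib)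
    next
      have "cnj \<omega> * (\<omega> * w) = w" "\<omega> * (cnj \<omega> * w) = w" for w
        using cn by (metis mult.assoc mult.commute mult_1)+
      then show "\<forall>w\<in>uroots M. cnj \<omega> * (\<omega> * w) = w" "\<forall>w\<in>uroots M. \<omega> * (cnj \<omega> * w) = w"
        by blast+
    qed
    define S where "S = (\<Sum>w\<in>uroots M. w ^ i * cnj w ^ j)"
    have "S = (\<Sum>w\<in>uroots M. (\<omega> * w) ^ i * cnj (\<omega> * w) ^ j)"
      unfolding S_def using sum.reindex_bij_betw[OF bij, of "\<lambda>w. w ^ i * cnj w ^ j"] by simp
    also have "\<dots> = \<omega> ^ i * cnj \<omega> ^ j * S"
      unfolding S_def sum_distrib_left by (simp add: power_mult_distrib mult_ac)
    finally have "\<omega> ^ j * S = \<omega> ^ j * (\<omega> ^ i * cnj \<omega> ^ j * S)"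
      by (rule arg_cong)
    also have "\<dots> = \<omega> ^ i * (\<omega> * cnj \<omega>) ^ j * S"
      by (simp only: power_mult_distrib mult_ac)
    finally have "S = 0" using cn ne by simp
    then show ?thesis using False by (simp add: umean_def S_def)
  qed
qed

lemma umean_coeff:
  fixes a :: "nat \<Rightarrow> complex"
  assumes "d < M" "j \<le> d"
  shows "umean M (\<lambda>w. (\<Sum>i\<le>d. a i * w ^ i) * cnj w ^ j) = a j"
proof -
  have "umean M (\<lambda>w. (\<Sum>i\<le>d. a i * w ^ i) * cnj w ^ j)
      = umean M (\<lambda>w. \<Sum>i\<le>d. a i * (w ^ i * cnj w ^ j))"
    by (simp add: sum_distrib_right mult.assoc)
  also have "\<dots> = (\<Sum>i\<le>d. a i * (if i = j then 1 else 0))"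
    unfolding umean_sum umean_cmult
    by (intro sum.cong refl) (use assms in \<open>simp add: umean_orthogonal\<close>)
  also have "\<dots> = a j" using assms by (simp add: if_distrib cong: if_cong)
  finally show ?thesis .
qed

lemma norm_coeff_le_umean:
  fixes a :: "nat \<Rightarrow> complex"
  assumes "d < M" "j \<le> d"
  shows "cmod (a j) \<le> umean M (\<lambda>w. cmod (\<Sum>i\<le>d. a i * w ^ i))"
proof -
  have "cmod (a j) \<le> umean M (\<lambda>w. cmod ((\<Sum>i\<le>d. a i * w ^ i) * cnj w ^ j))"
    using norm_umean_le[of M "\<lambda>w. (\<Sum>i\<le>d. a i * w ^ i) * cnj w ^ j"] umean_coeff[OF assms, of a] by simp
  also have "\<dots> = umean M (\<lambda>w. cmod (\<Sum>i\<le>d. a i * w ^ i))"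
    by (rule umean_cong) (use assms norm_uroots[of M] in \<open>simp add: norm_mult norm_power\<close>)
  finally show ?thesis .
qed

text \<open>Parseval's identity, exact for the finite mean because \<open>d < M\<close> prevents
  aliasing.\<close>

lemma umean_norm_square:
  fixes a :: "nat \<Rightarrow> complex"
  assumes "d < M"
  shows "umean M (\<lambda>w. (cmod (\<Sum>i\<le>d. a i * w ^ i))\<^sup>2) = (\<Sum>j\<le>d. (cmod (a j))\<^sup>2)"
proof -
  have "complex_of_real (umean M (\<lambda>w. (cmod (\<Sum>i\<le>d. a i * w ^ i))\<^sup>2))
     = umean M (\<lambda>w. (\<Sum>i\<le>d. a i * w ^ i) * cnj (\<Sum>i\<le>d. a i * w ^ i))"
    by (simp add: umean_def complex_norm_square del: cnj_sum of_real_power)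
  also have "\<dots> = umean M (\<lambda>w. \<Sum>j\<le>d. cnj (a j) * ((\<Sum>i\<le>d. a i * w ^ i) * cnj w ^ j))"
    by (simp add: sum_distrib_left sum_distrib_right mult_ac)
  also have "\<dots> = (\<Sum>j\<le>d. cnj (a j) * a j)"
    unfolding umean_sum umean_cmult
    by (intro sum.cong refl) (use assms in \<open>simp add: umean_coeff\<close>)
  also have "\<dots> = complex_of_real (\<Sum>j\<le>d. (cmod (a j))\<^sup>2)"
    by (simp add: complex_norm_square mult.commute del: of_real_power)
  finally show ?thesis unfolding of_real_eq_iff .
qed

text \<open>Refining the nodes costs a factor that does not depend on \<open>K\<close>. Every fine
  node is within angle \<open>2 * pi / M\<close> of a coarse one, and a rotation by \<open>t\<close>
  changes \<open>f\<close> by at most \<open>(d + 1) * d * \<bar>t\<bar> * A\<close>, since each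
  coefficient is itself bounded by the coarse mean \<open>A\<close>.\<close>

lemma umean_mult_le:
  fixes a :: "nat \<Rightarrow> complex"
  assumes "d < M" "0 < K"
  shows "umean (M * K) (\<lambda>w. cmod (\<Sum>i\<le>d. a i * w ^ i))
    \<le> (1 + 2 * pi * real d * real (d + 1) / real M) * umean M (\<lambda>w. cmod (\<Sum>i\<le>d. a i * w ^ i))"
proof -
  define f where "f = (\<lambda>w. \<Sum>i\<le>d. a i * w ^ i)"
  define A where "A = umean M (\<lambda>w. cmod (f w))"
  have M: "0 < M" "0 < M * K" using assms by auto
  have aA: "cmod (a i) \<le> A" if "i \<le> d" for i
    using norm_coeff_le_umean[OF assms(1) that, of a] by (simp add: A_def f_def)
  \<comment> \<open>A chord is no longer than its arc.\<close>
  have cis1: "cmod (cis t - 1) \<le> \<bar>t\<bar>" for t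
  proof -
    have "(cmod (cis t - 1))\<^sup>2 = 2 - 2 * cos t"
      unfolding cmod_power2 using sin_cos_squared_add[of t] by (simp add: power2_diff)
    also have "\<dots> = 4 * (sin (t/2))\<^sup>2"
      using cos_double_sin[of "t/2"] by simp
    also have "\<dots> \<le> 4 * (t/2)\<^sup>2"
      using abs_sin_x_le_abs_x[of "t/2"] by (simp only: abs_le_square_iff)
    also have "\<dots> = \<bar>t\<bar>\<^sup>2" by (simp add: power2_eq_square)
    finally show ?thesis by (rule power2_le_imp_le) simp
  qed
  have rot: "cmod (f (w * cis t)) \<le> cmod (f w) + real (d + 1) * (real d * \<bar>t\<bar> * A)"
    if "cmod w = 1" for w t
  proof -
    have "cmod (f (w * cis t) - f w) = cmod (\<Sum>i\<le>d. a i * w ^ i * (cis (real i * t) - 1))"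
      unfolding f_def sum_subtractf[symmetric] by (simp add: power_mult_distrib Complex.DeMoivre algebra_simps)
    also have "\<dots> \<le> (\<Sum>i\<le>d. A * (real d * \<bar>t\<bar>))"
    proof (rule order.trans[OF norm_sum], rule sum_mono)
      fix i assume i: "i \<in> {..d}"
      have "cmod (cis (real i * t) - 1) \<le> real d * \<bar>t\<bar>"
        using order.trans[OF cis1[of "real i * t"], of "real d * \<bar>t\<bar>"] i
        by (simp add: abs_mult mult_right_mono)
      moreover have "cmod (a i) \<le> A" using aA i by simp
      ultimately have "cmod (a i) * cmod (cis (real i * t) - 1) \<le> A * (real d * \<bar>t\<bar>)"
        by (intro mult_mono') auto
      then show "cmod (a i * w ^ i * (cis (real i * t) - 1)) \<le> A * (real d * \<bar>t\<bar>)"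
        using that by (simp add: norm_mult norm_power)
    qed
    also have "\<dots> = real (d + 1) * (real d * \<bar>t\<bar> * A)" by (simp add: algebra_simps)
    finally show ?thesis using norm_triangle_ineq2[of "f (w * cis t)" "f w"] by linarith
  qed
  have A0: "0 \<le> A" using aA[of 0] norm_ge_zero[of "a 0"] by linarith
  define E where "E = real (d + 1) * (real d * (2 * pi / real M) * A)"
  \<comment> \<open>The fine nodes form \<open>M\<close> blocks of \<open>K\<close> consecutive
    ones; each block is compared with its first node, which is a coarse one.\<close>
  have "(\<Sum>l<M*K. cmod (f (cis (2 * pi * real l / real (M * K)))))
      = (\<Sum>l<M. \<Sum>s = l*K..<l*K+K. cmod (f (cis (2 * pi * real s / real (M * K)))))"
    by (rule sum.nat_group[symmetric])
  also have "\<dots> \<le> (\<Sum>l<M. \<Sum>s = l*K..<l*K+K. cmod (f (cis (2 * pi * real l / real M))) + E)"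
  proof (intro sum_mono)
    fix l s assume "l \<in> {..<M}" and s: "s \<in> {l*K..<l*K+K}"
    define t where "t = 2 * pi * real (s - l*K) / real (M * K)"
    have eq: "2 * pi * real s / real (M * K) = 2 * pi * real l / real M + t"
      using s M by (simp add: t_def field_simps of_nat_diff)
    have "real (s - l*K) / real (M * K) \<le> real K / real (M * K)"
      using s by (intro divide_right_mono of_nat_mono) auto
    then have "2 * pi * (real (s - l*K) / real (M * K)) \<le> 2 * pi * (1 / real M)"
      using assms by (intro mult_left_mono) auto
    moreover have "0 \<le> t" by (simp add: t_def)
    ultimately have t: "\<bar>t\<bar> \<le> 2 * pi / real M" by (simp add: t_def)
    have "cmod (f (cis (2 * pi * real s / real (M * K))))
        \<le> cmod (f (cis (2 * pi * real l / real M))) + real (d + 1) * (real d * \<bar>t\<bar> * A)"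
      unfolding eq using rot[of "cis (2 * pi * real l / real M)" t] by (simp add: cis_mult)
    also have "real (d + 1) * (real d * \<bar>t\<bar> * A) \<le> E"
      unfolding E_def using t A0 by (intro mult_left_mono mult_right_mono) auto
    finally show "cmod (f (cis (2 * pi * real s / real (M * K)))) \<le> cmod (f (cis (2 * pi * real l / real M))) + E"
      by simp
  qed
  also have "\<dots> = real K * (\<Sum>l<M. cmod (f (cis (2 * pi * real l / real M)))) + real (M * K) * E"
    by (simp add: sum.distrib sum_distrib_left algebra_simps)
  finally have "umean (M * K) (\<lambda>w. cmod (f w)) \<le>
     (real K * (\<Sum>l<M. cmod (f (cis (2 * pi * real l / real M)))) + real (M * K) * E) / real (M * K)"
    unfolding umean_cis[OF M(2)] by (rule divide_right_mono) simp
  also have "\<dots> = A + E" using assms M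
    unfolding A_def umean_cis[OF M(1)] by (simp add: field_simps)
  also have "\<dots> = (1 + 2 * pi * real d * real (d + 1) / real M) * A"
    by (simp add: E_def field_simps)
  finally show ?thesis by (simp add: A_def f_def)
qed

section \<open>Carleman's inequality\<close>

lemma poly_eq_sum_atMost:
  fixes p :: "complex poly"
  assumes "degree p \<le> d"
  shows "poly p z = (\<Sum>i\<le>d. poly.coeff p i * z ^ i)"
proof -
  have "(\<Sum>i\<le>degree p. poly.coeff p i * z ^ i) = (\<Sum>i\<le>d. poly.coeff p i * z ^ i)"
    using assms by (intro sum.mono_neutral_left) (auto simp: coeff_eq_0)
  then show ?thesis by (simp add: poly_altdef)
qed

text \<open>The finitely many zeros stay outside a disc of radius \<open>R > 1\<close>, where
  \<open>p\<close> has a holomorphic square root. Its Taylor series then converges absolutely on the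
  closed unit disc, and uniqueness of expansions gives the convolution formula for the
  coefficients.\<close>

lemma poly_sqrt_series:
  fixes p :: "complex poly"
  assumes nz: "\<And>z. cmod z \<le> 1 \<Longrightarrow> poly p z \<noteq> 0"
  obtains h :: "nat \<Rightarrow> complex" where
    "summable (\<lambda>n. cmod (h n))"
    "\<And>j. poly.coeff p j = (\<Sum>i\<le>j. h i * h (j - i))"
    "\<And>w. cmod w = 1 \<Longrightarrow> poly p w = (\<Sum>n. h n * w ^ n)\<^sup>2"
proof -
  have p0: "p \<noteq> 0" using nz[of 0] by auto
  define Z where "Z = cmod ` {z. poly p z = 0}"
  have fin: "finite Z" unfolding Z_def using poly_roots_finite[OF p0] by simp
  \<comment> \<open>The element 2 provides a radius when \<open>p\<close> has no zeros.\<close>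
  define R where "R = Min (insert 2 Z)"
  have R1: "1 < R"
    unfolding R_def using fin nz by (subst Min_gr_iff) (auto simp: Z_def not_le[symmetric])
  have nzR: "poly p z \<noteq> 0" if "z \<in> ball 0 R" for z
  proof
    assume "poly p z = 0"
    then have "R \<le> cmod z" unfolding R_def using fin by (intro Min_le) (auto simp: Z_def)
    then show False using that by simp
  qed
  obtain g where g: "g holomorphic_on ball 0 R" "\<And>z. z \<in> ball 0 R \<Longrightarrow> poly p z = g z ^ 2"
  proof (rule contractible_imp_holomorphic_sqrt[of "poly p" "ball 0 R"])
    show "contractible (ball (0::complex) R)" by (intro convex_imp_contractible convex_ball)
    show "poly p holomorphic_on ball 0 R" by (intro holomorphic_intros)
  qed (use nzR that in auto)
  define F where "F = fps_expansion g 0"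
  have gF: "g has_fps_expansion F"
    unfolding F_def using g(1) R1 by (intro has_fps_expansion_fps_expansion[of "ball 0 R"]) auto
  have ev: "\<forall>\<^sub>F z in nhds 0. z \<in> ball (0::complex) R"
    using R1 by (intro eventually_nhds_in_open) auto
  have "(\<lambda>z. g z * g z) has_fps_expansion fps_of_poly p"
    unfolding has_fps_expansion_def using ev
    by (auto simp: g(2) power2_eq_square elim: eventually_mono)
  with has_fps_expansion_mult[OF gF gF] have FF: "fps_of_poly p = F * F"
    by (rule fps_expansion_unique_complex[rotated])
  define h where "h = fps_nth F"
  have sums: "(\<lambda>n. h n * w ^ n) sums g w" if "cmod w < R" for w
    using holomorphic_power_series[OF g(1), of w] that
    by (simp add: h_def fps_nth_fps_expansion[OF gF])
  show ?thesis
  proof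
    \<comment> \<open>Convergence at a point of modulus strictly between 1 and \<open>R\<close>
      yields absolute convergence at 1.\<close>
    define r where "r = complex_of_real ((1 + R) / 2)"
    have "cmod r = (1 + R) / 2" using R1 by (simp add: r_def norm_of_real del: of_real_divide of_real_add)
    then have r: "cmod r < R" "cmod 1 < cmod r" using R1 by auto
    show "summable (\<lambda>n. cmod (h n))"
      using powser_insidea[OF sums_summable[OF sums[OF r(1)]] r(2)] by simp
    show "poly.coeff p j = (\<Sum>i\<le>j. h i * h (j - i))" for j
      using arg_cong[OF FF, of "\<lambda>G. fps_nth G j"] by (simp add: fps_mult_nth h_def atMost_atLeast0)
    show "poly p w = (\<Sum>n. h n * w ^ n)\<^sup>2" if "cmod w = 1" for w
      using sums_unique[OF sums[of w]] g(2)[of w] that R1 by simp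
  qed
qed

text \<open>With \<open>p = h^2\<close> the squared \<open>L_2\<close>-norm of \<open>h\<close> is
  the \<open>L_1\<close>-norm of \<open>p\<close>. The \<open>j\<close>-th coefficient of
  \<open>p\<close> is a convolution of \<open>j + 1\<close> products of coefficients of
  \<open>h\<close>, so Cauchy--Schwarz produces the weight \<open>1 / (j + 1)\<close>.\<close>

lemma poly_carleman_nonvanishing_cball:
  fixes p :: "complex poly"
  assumes nz: "\<And>z. cmod z \<le> 1 \<Longrightarrow> poly p z \<noteq> 0" and d: "degree p \<le> d" and M: "d < M"
  shows "(\<Sum>j\<le>d. (cmod (poly.coeff p j))\<^sup>2 / real (j + 1))
    \<le> ((1 + 2 * pi * real d * real (d + 1) / real M) * umean M (\<lambda>w. cmod (poly p w)))\<^sup>2"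
proof -
  define A where "A = (1 + 2 * pi * real d * real (d + 1) / real M) * umean M (\<lambda>w. cmod (poly p w))"
  obtain h :: "nat \<Rightarrow> complex" where
    sm: "summable (\<lambda>n. cmod (h n))" and
    co: "\<And>j. poly.coeff p j = (\<Sum>i\<le>j. h i * h (j - i))" and
    sq: "\<And>w. cmod w = 1 \<Longrightarrow> poly p w = (\<Sum>n. h n * w ^ n)\<^sup>2"
    using poly_sqrt_series[OF nz] by blast
  define H where "H = (\<Sum>n. cmod (h n))"
  \<comment> \<open>The tail of the absolute series, a bound for the truncation error that is
    uniform on the circle.\<close>
  define \<tau> where "\<tau> = (\<lambda>L. H - (\<Sum>n<Suc L. cmod (h n)))"
  have \<tau>0: "\<tau> \<longlonglongrightarrow> 0"
  proof -
    have "(\<lambda>L. \<Sum>n<L. cmod (h n)) \<longlonglongrightarrow> H"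
      unfolding H_def using sm by (rule summable_LIMSEQ)
    from tendsto_diff[OF tendsto_const[of H] LIMSEQ_Suc[OF this]] show ?thesis
      by (simp add: \<tau>_def)
  qed
  have \<tau>nn: "0 \<le> \<tau> L" for L
    unfolding \<tau>_def H_def using sum_le_suminf[OF sm, of "{..<Suc L}"] by simp
  have main: "(\<Sum>i\<le>d. (cmod (h i))\<^sup>2) \<le> A + 2 * H * \<tau> L" if L: "d \<le> L" for L
  proof -
    define g where "g = (\<lambda>w. \<Sum>n. h n * w ^ n)"
    define T where "T = (\<lambda>w. \<Sum>n\<le>L. h n * w ^ n)"
    have pt: "(cmod (T w))\<^sup>2 \<le> cmod (poly p w) + 2 * H * \<tau> L" if w: "cmod w = 1" for w
    proof -
      have smw: "summable (\<lambda>n. cmod (h n * w ^ n))" using sm w by (simp add: norm_mult norm_power)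
      have gT: "cmod (g w - T w) \<le> \<tau> L"
      proof -
        have "g w = (\<Sum>n. h (n + Suc L) * w ^ (n + Suc L)) + (\<Sum>n<Suc L. h n * w ^ n)"
          unfolding g_def by (rule suminf_split_initial_segment[OF summable_norm_cancel[OF smw]])
        then have "cmod (g w - T w) = cmod (\<Sum>n. h (n + Suc L) * w ^ (n + Suc L))"
          by (simp add: T_def lessThan_Suc_atMost)
        also have "\<dots> \<le> (\<Sum>n. cmod (h (n + Suc L) * w ^ (n + Suc L)))"
          by (intro summable_norm summable_ignore_initial_segment[OF smw])
        also have "\<dots> = (\<Sum>n. cmod (h (n + Suc L)))"
          using w by (simp add: norm_mult norm_power)
        also have "\<dots> = \<tau> L"
          unfolding \<tau>_def H_def using suminf_split_initial_segment[OF sm, of "Suc L"] by simp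
        finally show ?thesis .
      qed
      have gH: "cmod (g w) \<le> H"
        unfolding g_def H_def using summable_norm[OF smw] w by (simp add: norm_mult norm_power)
      have "cmod (T w) \<le> (\<Sum>n\<le>L. cmod (h n))"
        unfolding T_def using norm_sum[of "\<lambda>n. h n * w ^ n" "{..L}"] w by (simp add: norm_mult norm_power)
      also have "\<dots> \<le> H" unfolding H_def by (intro sum_le_suminf sm) auto
      finally have TH: "cmod (T w) \<le> H" .
      have dif: "cmod (T w) - cmod (g w) \<le> \<tau> L"
        using gT norm_triangle_ineq2[of "T w" "g w"] by (simp add: norm_minus_commute)
      have "(cmod (T w))\<^sup>2 - (cmod (g w))\<^sup>2 = (cmod (T w) + cmod (g w)) * (cmod (T w) - cmod (g w))"
        by (simp add: power2_eq_square algebra_simps)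
      also have "\<dots> \<le> (cmod (T w) + cmod (g w)) * \<tau> L"
        using dif by (intro mult_left_mono) auto
      also have "\<dots> \<le> 2 * H * \<tau> L"
        using TH gH \<tau>nn[of L] by (intro mult_right_mono) auto
      finally have "(cmod (T w))\<^sup>2 \<le> (cmod (g w))\<^sup>2 + 2 * H * \<tau> L" by simp
      then show ?thesis using sq[OF w] by (simp add: g_def norm_power)
    qed
    \<comment> \<open>With \<open>M * K\<close> nodes Parseval is exact for the truncation
      \<open>T\<close> of degree \<open>L\<close>, while the mean of \<open>cmod (poly p w)\<close>
      is still controlled by the one over \<open>M\<close> nodes.\<close>
    define K where "K = Suc L"
    have MK: "L < M * K" "0 < M * K" "0 < K"
    proof -
      have "K \<le> M * K" using M by (cases M) auto
      then show "L < M * K" "0 < M * K" "0 < K" by (auto simp: K_def)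
    qed
    have "(\<Sum>i\<le>d. (cmod (h i))\<^sup>2) \<le> (\<Sum>i\<le>L. (cmod (h i))\<^sup>2)"
      using L by (intro sum_mono2) auto
    also have "\<dots> = umean (M * K) (\<lambda>w. (cmod (T w))\<^sup>2)"
      unfolding T_def using umean_norm_square[OF MK(1), of h] by simp
    also have "\<dots> \<le> umean (M * K) (\<lambda>w. cmod (poly p w) + 2 * H * \<tau> L)"
      by (intro umean_mono pt norm_uroots[OF MK(2)])
    also have "\<dots> = umean (M * K) (\<lambda>w. cmod (poly p w)) + 2 * H * \<tau> L"
      using MK(2) by (simp add: umean_add umean_const)
    also have "umean (M * K) (\<lambda>w. cmod (poly p w)) \<le> A"
      unfolding A_def poly_eq_sum_atMost[OF d] by (rule umean_mult_le[OF M MK(3)])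
    finally show ?thesis by simp
  qed
  have "(\<lambda>L. A + 2 * H * \<tau> L) \<longlonglongrightarrow> A + 2 * H * 0"
    by (intro tendsto_intros \<tau>0)
  then have hA: "(\<Sum>i\<le>d. (cmod (h i))\<^sup>2) \<le> A"
    using LIMSEQ_le_const[of _ A] main by auto
  have "(\<Sum>j\<le>d. (cmod (poly.coeff p j))\<^sup>2 / real (j + 1))
      \<le> (\<Sum>j\<le>d. \<Sum>i\<le>j. (cmod (h i))\<^sup>2 * (cmod (h (j - i)))\<^sup>2)"
  proof (rule sum_mono)
    fix j
    have "(cmod (poly.coeff p j))\<^sup>2 \<le> (\<Sum>i\<le>j. cmod (h i) * cmod (h (j - i)))\<^sup>2"
      unfolding co using norm_sum[of "\<lambda>i. h i * h (j - i)" "{..j}"]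
      by (intro power_mono) (simp_all add: norm_mult)
    also have "\<dots> \<le> (\<Sum>i\<le>j. (cmod (h i) * cmod (h (j - i)))\<^sup>2) * card {..j}"
      by (rule sum_squared_le_sum_of_squares)
    finally show "(cmod (poly.coeff p j))\<^sup>2 / real (j + 1) \<le> (\<Sum>i\<le>j. (cmod (h i))\<^sup>2 * (cmod (h (j - i)))\<^sup>2)"
      by (simp add: field_simps power_mult_distrib)
  qed
  \<comment> \<open>The convolution sums run over a triangle of index pairs, which is enlarged to
    the full square to obtain a product.\<close>
  also have "\<dots> = (\<Sum>(i,j)\<in>{(i,j). i + j \<le> d}. (cmod (h i))\<^sup>2 * (cmod (h j))\<^sup>2)"
    by (rule sum.triangle_reindex_eq[symmetric])
  also have "\<dots> \<le> (\<Sum>(i,j)\<in>{..d}\<times>{..d}. (cmod (h i))\<^sup>2 * (cmod (h j))\<^sup>2)"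
    by (intro sum_mono2) auto
  also have "\<dots> = (\<Sum>i\<le>d. (cmod (h i))\<^sup>2)\<^sup>2"
    by (simp add: power2_eq_square sum_product sum.cartesian_product)
  also have "\<dots> \<le> A\<^sup>2"
    using hA by (intro power_mono) (auto intro: sum_nonneg)
  finally show ?thesis unfolding A_def .
qed

lemma poly_carleman_nonvanishing_ball:
  fixes p :: "complex poly"
  assumes nz: "\<And>z. cmod z < 1 \<Longrightarrow> poly p z \<noteq> 0" and d: "degree p \<le> d" and M: "d < M"
  shows "(\<Sum>j\<le>d. (cmod (poly.coeff p j))\<^sup>2 / real (j + 1))
    \<le> ((1 + 2 * pi * real d * real (d + 1) / real M) * umean M (\<lambda>w. cmod (poly p w)))\<^sup>2"
proof -
  define s where "s = (\<lambda>n. complex_of_real (1 - 1 / real (n + 2)))"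
  define P where "P = (\<lambda>n. pcompose p [:0, s n:])"
  have s1: "cmod (s n) < 1" and s0: "s n \<noteq> 0" for n
    by (auto simp: s_def field_simps norm_of_real abs_if simp del: of_real_diff of_real_divide of_real_add)
  have "(\<lambda>n. 1 - 1 / real (n + 2)) \<longlonglongrightarrow> 1 - 0"
    by (intro tendsto_intros LIMSEQ_ignore_initial_segment lim_1_over_n)
  from tendsto_of_real[OF this, where ?'a = complex] have slim: "s \<longlonglongrightarrow> 1"
    unfolding s_def by simp
  have coP: "poly.coeff (P n) j = s n ^ j * poly.coeff p j" for n j
    by (simp add: P_def coeff_pcompose_linear)
  have poP: "poly (P n) w = poly p (s n * w)" for n w
    by (simp add: P_def poly_pcompose mult.commute)
  have le: "(\<Sum>j\<le>d. (cmod (poly.coeff (P n) j))\<^sup>2 / real (j + 1))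
    \<le> ((1 + 2 * pi * real d * real (d + 1) / real M) * umean M (\<lambda>w. cmod (poly (P n) w)))\<^sup>2" for n
  proof (rule poly_carleman_nonvanishing_cball[OF _ _ M])
    show "poly (P n) z \<noteq> 0" if "cmod z \<le> 1" for z
    proof -
      have "cmod (s n) * cmod z \<le> cmod (s n) * 1" using that by (intro mult_left_mono) auto
      then have "cmod (s n * z) < 1" using s1[of n] by (simp add: norm_mult)
      then show ?thesis unfolding poP by (rule nz)
    qed
    show "degree (P n) \<le> d" using d s0[of n] by (simp add: P_def degree_pcompose)
  qed
  have l1: "(\<lambda>n. \<Sum>j\<le>d. (cmod (poly.coeff (P n) j))\<^sup>2 / real (j + 1))
      \<longlonglongrightarrow> (\<Sum>j\<le>d. (cmod (1 ^ j * poly.coeff p j))\<^sup>2 / real (j + 1))"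
    unfolding coP by (intro tendsto_intros slim) auto
  have l2: "(\<lambda>n. ((1 + 2 * pi * real d * real (d + 1) / real M) * umean M (\<lambda>w. cmod (poly (P n) w)))\<^sup>2)
      \<longlonglongrightarrow> ((1 + 2 * pi * real d * real (d + 1) / real M) * umean M (\<lambda>w. cmod (poly p (1 * w))))\<^sup>2"
    unfolding poP umean_def using M by (intro tendsto_intros slim) auto
  show ?thesis using LIMSEQ_le[OF l1 l2] le by (simp only: mult_1 power_one) blast
qed

text \<open>Replacing a zero \<open>\<rho>\<close> in the disc by its reflection \<open>1 / cnj \<rho>\<close> keeps the modulus on the
  circle and, as \<open>\<bar>1 - cnj \<rho> z\<bar>\<^sup>2 - \<bar>z - \<rho>\<bar>\<^sup>2 = (1 - \<bar>\<rho>\<bar>\<^sup>2) (1 - \<bar>z\<bar>\<^sup>2)\<close>, can only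
  increase it inside.\<close>

lemma poly_reflect_zeros:
  fixes p :: "complex poly"
  assumes "p \<noteq> 0"
  obtains q where "degree q \<le> degree p" "\<And>z. cmod z < 1 \<Longrightarrow> poly q z \<noteq> 0"
    "\<And>z. cmod z = 1 \<Longrightarrow> cmod (poly q z) = cmod (poly p z)"
    "\<And>z. cmod z \<le> 1 \<Longrightarrow> cmod (poly p z) \<le> cmod (poly q z)"
proof -
  have "\<exists>q. degree q \<le> degree p \<and> (\<forall>z. cmod z < 1 \<longrightarrow> poly q z \<noteq> 0) \<and>
    (\<forall>z. cmod z = 1 \<longrightarrow> cmod (poly q z) = cmod (poly p z)) \<and>
    (\<forall>z. cmod z \<le> 1 \<longrightarrow> cmod (poly p z) \<le> cmod (poly q z))"
    using assms
  proof (induction "degree p" arbitrary: p rule: less_induct)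
    case less
    show ?case
    proof (cases "\<exists>\<rho>. cmod \<rho> < 1 \<and> poly p \<rho> = 0")
      case False
      then show ?thesis by blast
    next
      case True
      then obtain \<rho> where \<rho>: "cmod \<rho> < 1" "poly p \<rho> = 0" by blast
      then obtain p' where p': "p = [:- \<rho>, 1:] * p'" unfolding poly_eq_0_iff_dvd by (elim conjE dvdE)
      have p'0: "p' \<noteq> 0" using less.prems p' by auto
      have deg: "degree p = Suc (degree p')"
        unfolding p' using p'0 by (subst degree_mult_eq) auto
      have "degree p' < degree p" using deg by simp
      from less.hyps[OF this p'0] obtain q where q: "degree q \<le> degree p'" "\<And>z. cmod z < 1 \<Longrightarrow> poly q z \<noteq> 0"
        "\<And>z. cmod z = 1 \<Longrightarrow> cmod (poly q z) = cmod (poly p' z)"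
        "\<And>z. cmod z \<le> 1 \<Longrightarrow> cmod (poly p' z) \<le> cmod (poly q z)"
        by blast
      have id: "(cmod (1 - cnj \<rho> * z))\<^sup>2 - (cmod (z - \<rho>))\<^sup>2 = (1 - (cmod \<rho>)\<^sup>2) * (1 - (cmod z)\<^sup>2)" for z
      proof -
        have "complex_of_real ((cmod (1 - cnj \<rho> * z))\<^sup>2 - (cmod (z - \<rho>))\<^sup>2)
            = complex_of_real ((1 - (cmod \<rho>)\<^sup>2) * (1 - (cmod z)\<^sup>2))"
          by (simp add: complex_norm_square algebra_simps del: of_real_power)
        then show ?thesis unfolding of_real_eq_iff .
      qed
      have le: "cmod (z - \<rho>) \<le> cmod (1 - cnj \<rho> * z)" if "cmod z \<le> 1" for z
      proof (rule power2_le_imp_le)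
        have "0 \<le> (1 - (cmod \<rho>)\<^sup>2) * (1 - (cmod z)\<^sup>2)"
          using that \<rho> by (intro mult_nonneg_nonneg) (auto simp: power_le_one)
        then show "(cmod (z - \<rho>))\<^sup>2 \<le> (cmod (1 - cnj \<rho> * z))\<^sup>2" using id[of z] by linarith
      qed simp
      have eq: "cmod (1 - cnj \<rho> * z) = cmod (z - \<rho>)" if "cmod z = 1" for z
      proof (rule power2_eq_imp_eq)
        show "(cmod (1 - cnj \<rho> * z))\<^sup>2 = (cmod (z - \<rho>))\<^sup>2"
          using id[of z] unfolding that by simp
      qed simp_all
      have ev: "poly ([:1, - cnj \<rho>:] * q) z = (1 - cnj \<rho> * z) * poly q z" for z
        by (simp add: algebra_simps)
      have evp: "poly p z = (z - \<rho>) * poly p' z" for z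
        unfolding p' by (simp add: algebra_simps)
      show ?thesis
      proof (intro exI[of _ "[:1, - cnj \<rho>:] * q"] conjI allI impI)
        have "degree ([:1, - cnj \<rho>:] * q) \<le> degree [:1, - cnj \<rho>:] + degree q"
          by (rule degree_mult_le)
        also have "\<dots> \<le> degree p" using q(1) deg by simp
        finally show "degree ([:1, - cnj \<rho>:] * q) \<le> degree p" .
        fix z
        show "poly ([:1, - cnj \<rho>:] * q) z \<noteq> 0" if z: "cmod z < 1"
        proof -
          have "cmod (cnj \<rho> * z) < 1"
            using mult_strict_mono[of "cmod \<rho>" 1 "cmod z" 1] \<rho>(1) z by (simp add: norm_mult)
          then have "cnj \<rho> * z \<noteq> 1" by force
          then have "1 - cnj \<rho> * z \<noteq> 0" by simp
          then show ?thesis unfolding ev using q(2)[OF z] by simp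
        qed
        show "cmod (poly ([:1, - cnj \<rho>:] * q) z) = cmod (poly p z)" if "cmod z = 1"
          unfolding ev evp norm_mult using q(3) eq that by simp
        show "cmod (poly p z) \<le> cmod (poly ([:1, - cnj \<rho>:] * q) z)" if "cmod z \<le> 1"
          unfolding ev evp norm_mult using q(4) le that by (intro mult_mono) auto
      qed
    qed
  qed
  then show ?thesis using that by blast
qed

text \<open>The left side squared is the mean square of the polynomial on the circle of radius
  \<open>1 / sqrt 2\<close>. Reflecting the zeros can only increase this and leaves the right side
  unchanged. For the reflected polynomial Carleman's inequality applies, as
  \<open>j + 1 \<le> 2 ^ j\<close>.\<close>

lemma hypercontractive_1:
  fixes a :: "nat \<Rightarrow> complex"
  assumes M: "d < M"
  shows "sqrt (\<Sum>j\<le>d. (cmod (a j))\<^sup>2 / 2 ^ j)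
    \<le> (1 + 2 * pi * real d * real (d + 1) / real M) * umean M (\<lambda>w. cmod (\<Sum>j\<le>d. a j * w ^ j))"
proof -
  define B where "B = 1 + 2 * pi * real d * real (d + 1) / real M"
  define p where "p = (\<Sum>j\<le>d. monom (a j) j)"
  have dp: "degree p \<le> d" unfolding p_def by (intro degree_sum_le) (auto intro: order.trans[OF degree_monom_le])
  have pp: "poly p z = (\<Sum>j\<le>d. a j * z ^ j)" for z by (simp add: p_def poly_sum poly_monom)
  have B: "0 \<le> B" by (simp add: B_def)
  have um: "0 \<le> umean M (\<lambda>w. cmod (poly q w))" for q
    unfolding umean_def by (intro divide_nonneg_nonneg sum_nonneg) auto
  \<comment> \<open>Reflection gives no comparison of individual coefficients, only of values inside
    the disc; hence the weights are expressed by values at \<open>r * w\<close>.\<close>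
  define r where "r = complex_of_real (1 / sqrt 2)"
  have r: "cmod r = 1 / sqrt 2" "cmod r \<le> 1" by (simp_all add: r_def norm_divide)
  have rj: "(cmod (b * r ^ j))\<^sup>2 = (cmod b)\<^sup>2 / 2 ^ j" for b j
  proof -
    have "(cmod (b * r ^ j))\<^sup>2 = (cmod b)\<^sup>2 * ((1 / sqrt 2)\<^sup>2) ^ j"
      unfolding norm_mult norm_power r(1) power_mult_distrib by (simp only: power_mult[symmetric] mult.commute)
    then show ?thesis by (simp add: power_divide)
  qed
  have rw: "(\<Sum>j\<le>d. (cmod (b j))\<^sup>2 / 2 ^ j) = umean M (\<lambda>w. (cmod (\<Sum>j\<le>d. b j * (r * w) ^ j))\<^sup>2)" for b
    using umean_norm_square[OF M, of "\<lambda>j. b j * r ^ j"] by (simp add: rj power_mult_distrib mult_ac)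
  have "(\<Sum>j\<le>d. (cmod (a j))\<^sup>2 / 2 ^ j) \<le> (B * umean M (\<lambda>w. cmod (poly p w)))\<^sup>2"
  proof (cases "p = 0")
    case True
    have "(\<Sum>j\<le>d. (cmod (a j))\<^sup>2 / 2 ^ j) = umean M (\<lambda>w. (cmod (poly p (r * w)))\<^sup>2)"
      unfolding rw pp ..
    then show ?thesis using True by (simp add: umean_def)
  next
    case False
    obtain q where q: "degree q \<le> degree p" "\<And>z. cmod z < 1 \<Longrightarrow> poly q z \<noteq> 0"
      "\<And>z. cmod z = 1 \<Longrightarrow> cmod (poly q z) = cmod (poly p z)"
      "\<And>z. cmod z \<le> 1 \<Longrightarrow> cmod (poly p z) \<le> cmod (poly q z)"
      using poly_reflect_zeros[OF False] by blast
    have dq: "degree q \<le> d" using q(1) dp by simp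
    have "(\<Sum>j\<le>d. (cmod (a j))\<^sup>2 / 2 ^ j) = umean M (\<lambda>w. (cmod (poly p (r * w)))\<^sup>2)"
      unfolding rw pp ..
    also have "\<dots> \<le> umean M (\<lambda>w. (cmod (poly q (r * w)))\<^sup>2)"
    proof (intro umean_mono power_mono q(4))
      fix w assume "w \<in> uroots M"
      then show "cmod (r * w) \<le> 1" using r(2) norm_uroots[of M w] M by (simp add: norm_mult)
    qed simp
    also have "\<dots> = (\<Sum>j\<le>d. (cmod (poly.coeff q j))\<^sup>2 / 2 ^ j)"
      unfolding rw poly_eq_sum_atMost[OF dq] ..
    also have "\<dots> \<le> (\<Sum>j\<le>d. (cmod (poly.coeff q j))\<^sup>2 / real (j + 1))"
    proof (intro sum_mono divide_left_mono)
      fix j :: nat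
      have "j + 1 \<le> 2 ^ j" by (induction j) auto
      then have "real (j + 1) \<le> real (2 ^ j)" by (rule of_nat_mono)
      then show "real (j + 1) \<le> 2 ^ j" by simp
    qed auto
    also have "\<dots> \<le> (B * umean M (\<lambda>w. cmod (poly q w)))\<^sup>2"
      unfolding B_def by (rule poly_carleman_nonvanishing_ball[OF q(2) dq M])
    also have "umean M (\<lambda>w. cmod (poly q w)) = umean M (\<lambda>w. cmod (poly p w))"
      using M by (intro umean_cong q(3) norm_uroots[of M]) auto
    finally show ?thesis .
  qed
  then have "sqrt (\<Sum>j\<le>d. (cmod (a j))\<^sup>2 / 2 ^ j) \<le> B * umean M (\<lambda>w. cmod (poly p w))"
    using B um by (intro real_le_lsqrt) auto
  then show ?thesis unfolding B_def pp .
qed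

text \<open>The factor occurs once for each of the \<open>n\<close> variables and in both square
  functions, hence the exponent \<open>2 * n\<close>.\<close>

lemma exists_hypercontractive_order:
  obtains M where "d < M" "(1 + 2 * pi * real d * real (d + 1) / real M) ^ (2 * n) \<le> 2"
proof -
  have "(\<lambda>M. (1 + 2 * pi * real d * real (d + 1) / real M) ^ (2 * n)) \<longlonglongrightarrow> (1 + 0) ^ (2 * n)"
    by (intro tendsto_intros lim_const_over_n)
  then have "\<forall>\<^sub>F M in sequentially. (1 + 2 * pi * real d * real (d + 1) / real M) ^ (2 * n) < 2"
    by (rule order_tendstoD) simp
  moreover have "\<forall>\<^sub>F M in sequentially. d < M" by (rule eventually_gt_at_top)
  ultimately have "\<forall>\<^sub>F M in sequentially. d < M \<and> (1 + 2 * pi * real d * real (d + 1) / real M) ^ (2 * n) < 2"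
    by eventually_elim simp
  then obtain M where "d < M" "(1 + 2 * pi * real d * real (d + 1) / real M) ^ (2 * n) < 2"
    using eventually_happens by force
  then show ?thesis using that by fastforce
qed

section \<open>Hypercontractivity on the torus\<close>

lemma sum_PiE_insert:
  assumes "x \<notin> F"
  shows "(\<Sum>g\<in>PiE (insert x F) T. f g) = (\<Sum>y\<in>T x. \<Sum>g\<in>PiE F T. f (g(x := y)))"
proof -
  have "(\<Sum>g\<in>PiE (insert x F) T. f g) = (\<Sum>yg\<in>T x \<times> PiE F T. f ((\<lambda>(y, g). g(x := y)) yg))"
    unfolding PiE_insert_eq by (rule sum.reindex[OF inj_combinator[OF assms], unfolded o_def])
  then show ?thesis by (simp add: sum.cartesian_product split_def)
qed

text \<open>Minkowski's inequality, from the triangle inequality by induction on the number of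
  summands.\<close>

lemma L2_set_sum_le: "L2_set (\<lambda>b. \<Sum>v\<in>V. f v b) A \<le> (\<Sum>v\<in>V. L2_set (f v) A)"
proof (induction V rule: infinite_finite_induct)
  case (insert v V)
  have "L2_set (\<lambda>b. \<Sum>v\<in>insert v V. f v b) A = L2_set (\<lambda>b. f v b + (\<Sum>v\<in>V. f v b)) A"
    using insert.hyps by simp
  also have "\<dots> \<le> L2_set (f v) A + L2_set (\<lambda>b. \<Sum>v\<in>V. f v b) A"
    by (rule L2_set_triangle_ineq)
  finally show ?case using insert by simp
qed (simp_all add: L2_set_def)

text \<open>Induction on the variables. The one-variable inequality in \<open>x\<close> is applied
  for every fixed exponent of the other variables, Minkowski moves the mean over \<open>x\<close>
  outside the \<open>L_2\<close>-norm, and the induction hypothesis treats the remaining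
  variables.\<close>

lemma hypercontractive_PiE:
  fixes c :: "('i \<Rightarrow> nat) \<Rightarrow> complex"
  assumes "finite F" and M: "d < M"
  shows "L2_set (\<lambda>\<alpha>. cmod (c \<alpha>) * (1 / sqrt 2) ^ (\<Sum>i\<in>F. \<alpha> i)) (PiE F (\<lambda>_. {..d}))
    \<le> (1 + 2 * pi * real d * real (d + 1) / real M) ^ card F
      * ((\<Sum>w\<in>PiE F (\<lambda>_. uroots M). cmod (\<Sum>\<alpha>\<in>PiE F (\<lambda>_. {..d}). c \<alpha> * (\<Prod>i\<in>F. w i ^ \<alpha> i))) / real M ^ card F)"
  using assms(1)
proof (induction F arbitrary: c rule: finite_induct)
  case empty
  then show ?case by simp
next
  case (insert x F)
  define r where "r = 1 / sqrt 2"
  define B where "B = 1 + 2 * pi * real d * real (d + 1) / real M"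
  define D where "D = (\<lambda>F. PiE F (\<lambda>_::'i. {..d}))"
  define U where "U = (\<lambda>F. PiE F (\<lambda>_::'i. uroots M))"
  define s where "s = (\<lambda>\<beta> :: 'i \<Rightarrow> nat. \<Sum>i\<in>F. \<beta> i)"
  \<comment> \<open>The coefficients, in the variables of \<open>F\<close>, of the polynomial with
    the variable \<open>x\<close> frozen at \<open>v\<close>.\<close>
  define cv where "cv = (\<lambda>v \<beta>. \<Sum>j\<le>d. c (\<beta>(x := j)) * v ^ j)"
  have B0: "0 \<le> B" by (simp add: B_def)
  have r0: "0 \<le> r" by (simp add: r_def)
  have one: "L2_set (\<lambda>j. cmod (a j) * r ^ j) {..d} \<le> B * umean M (\<lambda>w. cmod (\<Sum>j\<le>d. a j * w ^ j))" for a
  proof -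
    have "(r ^ j)\<^sup>2 = 1 / 2 ^ j" for j
      by (simp add: r_def power_divide flip: power_mult) (simp add: power_mult mult.commute[of j])
    then show ?thesis
      using hypercontractive_1[OF M, of a] by (simp add: L2_set_def power_mult_distrib B_def)
  qed
  have sx: "(\<Sum>i\<in>insert x F. (\<beta>(x := j)) i) = j + s \<beta>" for \<beta> j
    using insert.hyps by (simp add: s_def sum.insert) (intro sum.cong, auto)
  have "L2_set (\<lambda>\<alpha>. cmod (c \<alpha>) * r ^ (\<Sum>i\<in>insert x F. \<alpha> i)) (D (insert x F))
      = sqrt (\<Sum>j\<le>d. \<Sum>\<beta>\<in>D F. (cmod (c (\<beta>(x := j))) * r ^ (j + s \<beta>))\<^sup>2)"
    unfolding L2_set_def D_def sum_PiE_insert[OF insert.hyps(2)] sx ..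
  also have "\<dots> = sqrt (\<Sum>\<beta>\<in>D F. \<Sum>j\<le>d. (cmod (c (\<beta>(x := j))) * r ^ (j + s \<beta>))\<^sup>2)"
    by (subst sum.swap) simp
  also have "\<dots> = L2_set (\<lambda>\<beta>. L2_set (\<lambda>j. cmod (c (\<beta>(x := j))) * r ^ j) {..d} * r ^ s \<beta>) (D F)"
    unfolding L2_set_def
    by (simp add: power_mult_distrib power_add sum_distrib_left sum_distrib_right sum_nonneg mult_ac)
  also have "\<dots> \<le> L2_set (\<lambda>\<beta>. \<Sum>v\<in>uroots M. B / real M * (cmod (cv v \<beta>) * r ^ s \<beta>)) (D F)"
  proof (intro L2_set_mono)
    fix \<beta>
    have "L2_set (\<lambda>j. cmod (c (\<beta>(x := j))) * r ^ j) {..d} * r ^ s \<beta>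
        \<le> B * umean M (\<lambda>v. cmod (cv v \<beta>)) * r ^ s \<beta>"
      unfolding cv_def using r0 by (intro mult_right_mono one) auto
    also have "\<dots> = (\<Sum>v\<in>uroots M. B / real M * (cmod (cv v \<beta>) * r ^ s \<beta>))"
      unfolding umean_def by (simp add: sum_distrib_left sum_distrib_right sum_divide_distrib field_simps)
    finally show "L2_set (\<lambda>j. cmod (c (\<beta>(x := j))) * r ^ j) {..d} * r ^ s \<beta>
        \<le> (\<Sum>v\<in>uroots M. B / real M * (cmod (cv v \<beta>) * r ^ s \<beta>))" .
  qed (use r0 in auto)
  also have "\<dots> \<le> (\<Sum>v\<in>uroots M. L2_set (\<lambda>\<beta>. B / real M * (cmod (cv v \<beta>) * r ^ s \<beta>)) (D F))"
    by (rule L2_set_sum_le)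
  also have "\<dots> = (\<Sum>v\<in>uroots M. B / real M * L2_set (\<lambda>\<beta>. cmod (cv v \<beta>) * r ^ s \<beta>) (D F))"
    using B0 by (intro sum.cong refl L2_set_right_distrib[symmetric]) simp
  also have "\<dots> \<le> (\<Sum>v\<in>uroots M. B / real M * (B ^ card F * ((\<Sum>w\<in>U F. cmod (\<Sum>\<beta>\<in>D F. cv v \<beta> * (\<Prod>i\<in>F. w i ^ \<beta> i))) / real M ^ card F)))"
    unfolding r_def s_def B_def D_def U_def
    by (intro sum_mono mult_left_mono insert.IH) auto
  also have "\<dots> = B ^ card (insert x F) * ((\<Sum>v\<in>uroots M. \<Sum>w\<in>U F. cmod (\<Sum>\<beta>\<in>D F. cv v \<beta> * (\<Prod>i\<in>F. w i ^ \<beta> i))) / real M ^ card (insert x F))"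
    using insert.hyps by (simp add: sum_distrib_left sum_divide_distrib field_simps)
  also have "(\<Sum>v\<in>uroots M. \<Sum>w\<in>U F. cmod (\<Sum>\<beta>\<in>D F. cv v \<beta> * (\<Prod>i\<in>F. w i ^ \<beta> i)))
      = (\<Sum>w\<in>U (insert x F). cmod (\<Sum>\<alpha>\<in>D (insert x F). c \<alpha> * (\<Prod>i\<in>insert x F. w i ^ \<alpha> i)))"
  proof -
    have pr: "(\<Prod>i\<in>insert x F. (w(x := v)) i ^ (\<beta>(x := j)) i) = v ^ j * (\<Prod>i\<in>F. w i ^ \<beta> i)"
      for w :: "'i \<Rightarrow> complex" and v \<beta> j
      using insert.hyps by (simp add: prod.insert) (intro disjI2 prod.cong, auto)
    show ?thesis
      unfolding U_def D_def sum_PiE_insert[OF insert.hyps(2)] pr cv_def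
      by (subst (2) sum.swap) (simp add: sum_distrib_left sum_distrib_right mult_ac)
  qed
  finally show ?case unfolding r_def B_def U_def D_def .
qed

section \<open>Means over the discrete torus, monomials and multi-indices\<close>

definition torus :: "nat \<Rightarrow> ('n::finite \<Rightarrow> complex) set" where
  "torus M = {w. \<forall>i. w i \<in> uroots M}"

definition tmean :: "nat \<Rightarrow> (('n::finite \<Rightarrow> complex) \<Rightarrow> 'a::real_normed_field) \<Rightarrow> 'a" where
  "tmean M f = (\<Sum>w\<in>torus M. f w) / of_nat M ^ CARD('n)"

lemma torus_eq_PiE: "torus M = PiE UNIV (\<lambda>_. uroots M)"
  by (auto simp: torus_def PiE_def)

lemma card_torus: "0 < M \<Longrightarrow> card (torus M :: ('n::finite \<Rightarrow> complex) set) = M ^ CARD('n)"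
  unfolding torus_eq_PiE by (simp add: card_PiE card_uroots)

lemma norm_torus: "0 < M \<Longrightarrow> w \<in> torus M \<Longrightarrow> cmod (w i) = 1"
  by (auto simp: torus_def norm_uroots)

lemma tmean_cmult: "tmean M (\<lambda>w. c * f w) = c * tmean M f"
  by (simp add: tmean_def sum_distrib_left)

lemma tmean_add: "tmean M (\<lambda>w. f w + g w) = tmean M f + tmean M g"
  by (simp add: tmean_def sum.distrib add_divide_distrib)

lemma tmean_sum: "tmean M (\<lambda>w. \<Sum>i\<in>I. f i w) = (\<Sum>i\<in>I. tmean M (f i))"
  unfolding tmean_def by (subst sum.swap) (simp add: sum_divide_distrib)

lemma tmean_const: "0 < M \<Longrightarrow> tmean M (\<lambda>w. c) = c"
  by (simp add: tmean_def card_torus)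

lemma tmean_mono:
  fixes f g :: "('n::finite \<Rightarrow> complex) \<Rightarrow> real"
  shows "(\<And>w. w \<in> torus M \<Longrightarrow> f w \<le> g w) \<Longrightarrow> tmean M f \<le> tmean M g"
  unfolding tmean_def by (intro divide_right_mono sum_mono) auto

lemma tmean_le:
  fixes f :: "('n::finite \<Rightarrow> complex) \<Rightarrow> real"
  shows "0 < M \<Longrightarrow> (\<And>w. w \<in> torus M \<Longrightarrow> f w \<le> C) \<Longrightarrow> tmean M f \<le> C"
  using tmean_mono[of M f "\<lambda>_. C"] by (simp add: tmean_const)

lemma tmean_cong: "(\<And>w. w \<in> torus M \<Longrightarrow> f w = g w) \<Longrightarrow> tmean M f = tmean M g"
  unfolding tmean_def by (intro arg_cong2[of _ _ _ _ "(/)"] sum.cong) auto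

lemma norm_tmean_le: "norm (tmean M f) \<le> tmean M (\<lambda>w. norm (f w))"
  unfolding tmean_def norm_divide norm_power by (auto intro!: divide_right_mono norm_sum)

definition mpow :: "('n::finite \<Rightarrow> complex) \<Rightarrow> ('n \<Rightarrow> nat) \<Rightarrow> complex" where
  "mpow z \<alpha> = (\<Prod>i\<in>UNIV. z i ^ \<alpha> i)"

lemma mpoly_eval_mpow: "mpoly_eval I c z = (\<Sum>\<alpha>\<in>I. c \<alpha> * mpow z \<alpha>)"
  by (simp add: mpoly_eval_def mpow_def)

lemma mpow_mult: "mpow (\<lambda>i. z i * w i) \<alpha> = mpow z \<alpha> * mpow w \<alpha>"
  by (simp add: mpow_def power_mult_distrib prod.distrib)

lemma mpow_const_mult: "mpow (\<lambda>i. t * z i) \<alpha> = t ^ deg \<alpha> * mpow z \<alpha>"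
  by (simp add: mpow_def power_mult_distrib prod.distrib power_sum deg_def)

lemma norm_mpow: "cmod (mpow z \<alpha>) = (\<Prod>i\<in>UNIV. cmod (z i) ^ \<alpha> i)"
  by (simp add: mpow_def norm_power prod_norm[symmetric])

lemma norm_mpow_torus: "0 < M \<Longrightarrow> w \<in> torus M \<Longrightarrow> cmod (mpow w \<alpha>) = 1"
  by (simp add: norm_mpow norm_torus)

text \<open>The mean factorises over the coordinates into one-variable means.\<close>

lemma tmean_orthogonal:
  fixes \<alpha> \<beta> :: "'n::finite \<Rightarrow> nat"
  assumes "\<And>i. \<alpha> i < M" "\<And>i. \<beta> i < M"
  shows "tmean M (\<lambda>w. mpow w \<alpha> * cnj (mpow w \<beta>)) = (if \<alpha> = \<beta> then 1 else 0)"
proof -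
  have M: "0 < M" using assms(1)[of undefined] by simp
  have "tmean M (\<lambda>w. mpow w \<alpha> * cnj (mpow w \<beta>))
      = (\<Sum>w\<in>PiE UNIV (\<lambda>_. uroots M). \<Prod>i\<in>UNIV. w i ^ \<alpha> i * cnj (w i) ^ \<beta> i) / of_nat M ^ CARD('n)"
    by (simp add: tmean_def torus_eq_PiE mpow_def prod.distrib)
  also have "\<dots> = (\<Prod>i\<in>UNIV. \<Sum>v\<in>uroots M. v ^ \<alpha> i * cnj v ^ \<beta> i) / of_nat M ^ CARD('n)"
    by (subst prod_sum_PiE) (use finite_uroots[OF M] in auto)
  also have "\<dots> = (\<Prod>i\<in>UNIV. umean M (\<lambda>v. v ^ \<alpha> i * cnj v ^ \<beta> i))"
    by (simp add: umean_def prod_dividef)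
  also have "\<dots> = (\<Prod>i\<in>UNIV. if \<alpha> i = \<beta> i then 1 else 0)"
    by (simp add: umean_orthogonal assms)
  also have "\<dots> = (if \<alpha> = \<beta> then 1 else 0)"
    by (auto simp: fun_eq_iff)
  finally show ?thesis .
qed

lemma tmean_coeff:
  fixes I :: "('n::finite \<Rightarrow> nat) set"
  assumes fin: "finite I" and lt: "\<And>\<alpha> i. \<alpha> \<in> I \<Longrightarrow> \<alpha> i < M" and "\<beta> \<in> I"
  shows "tmean M (\<lambda>w. mpoly_eval I c w * cnj (mpow w \<beta>)) = c \<beta>"
proof -
  have "tmean M (\<lambda>w. mpoly_eval I c w * cnj (mpow w \<beta>))
      = tmean M (\<lambda>w. \<Sum>\<alpha>\<in>I. c \<alpha> * (mpow w \<alpha> * cnj (mpow w \<beta>)))"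
    by (simp add: mpoly_eval_mpow sum_distrib_right mult.assoc)
  also have "\<dots> = (\<Sum>\<alpha>\<in>I. c \<alpha> * (if \<alpha> = \<beta> then 1 else 0))"
    unfolding tmean_sum tmean_cmult
    by (intro sum.cong refl arg_cong[where f = "(*) _"] tmean_orthogonal lt assms)
  also have "\<dots> = c \<beta>" using assms by (simp add: if_distrib cong: if_cong)
  finally show ?thesis .
qed

lemma le_deg: "\<alpha> i \<le> deg \<alpha>" for \<alpha> :: "'n::finite \<Rightarrow> nat"
  unfolding deg_def by (rule member_le_sum) auto

lemma finite_deg_le: "finite {\<alpha> :: 'n::finite \<Rightarrow> nat. deg \<alpha> \<le> m}"
proof (rule finite_subset)
  show "{\<alpha> :: 'n \<Rightarrow> nat. deg \<alpha> \<le> m} \<subseteq> PiE UNIV (\<lambda>_. {..m})"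
    using le_deg by (auto simp: PiE_def intro: order.trans)
qed (intro finite_PiE, auto)

lemma finite_Lambda: "finite (Lambda k :: ('n::finite \<Rightarrow> nat) set)"
  by (rule finite_subset[OF _ finite_deg_le[of k]]) (auto simp: Lambda_def)

text \<open>On exponents of degree \<open>d\<close> the weight is the constant
  \<open>(1 / sqrt 2) ^ d\<close>, which moves to the other side as
  \<open>sqrt 2 ^ d\<close>.\<close>

lemma hypercontractive_homogeneous:
  fixes I :: "('n::finite \<Rightarrow> nat) set"
  assumes I: "I \<subseteq> Lambda d" and M: "d < M"
  shows "L2_set (\<lambda>\<alpha>. cmod (c \<alpha>)) I
    \<le> sqrt 2 ^ d * (1 + 2 * pi * real d * real (d + 1) / real M) ^ CARD('n)
       * tmean M (\<lambda>w. cmod (mpoly_eval I c w))"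
proof -
  \<comment> \<open>Extension by zero to the full box of exponents up to \<open>d\<close>.\<close>
  define c' where "c' = (\<lambda>\<alpha>. if \<alpha> \<in> I then c \<alpha> else 0)"
  define D where "D = PiE (UNIV :: 'n set) (\<lambda>_. {..d})"
  have finD: "finite D" unfolding D_def by (intro finite_PiE) auto
  have ID: "I \<subseteq> D"
  proof
    fix \<alpha> assume "\<alpha> \<in> I"
    then have "deg \<alpha> = d" using I by (auto simp: Lambda_def)
    then show "\<alpha> \<in> D" using le_deg[of \<alpha>] by (auto simp: D_def PiE_def)
  qed
  have ev: "(\<Sum>\<alpha>\<in>D. c' \<alpha> * (\<Prod>i\<in>UNIV. w i ^ \<alpha> i)) = mpoly_eval I c w" for w
    unfolding mpoly_eval_def c'_def using finD ID by (intro sum.mono_neutral_cong_right) auto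
  have "(\<Sum>\<alpha>\<in>D. (cmod (c' \<alpha>) * (1 / sqrt 2) ^ (\<Sum>i\<in>UNIV. \<alpha> i))\<^sup>2) = (\<Sum>\<alpha>\<in>I. (cmod (c \<alpha>) * (1 / sqrt 2) ^ d)\<^sup>2)"
  proof (intro sum.mono_neutral_cong_right finD ID)
    fix \<alpha> assume "\<alpha> \<in> I"
    moreover then have "(\<Sum>i\<in>UNIV. \<alpha> i) = d" using I by (auto simp: Lambda_def deg_def)
    ultimately show "(cmod (c' \<alpha>) * (1 / sqrt 2) ^ (\<Sum>i\<in>UNIV. \<alpha> i))\<^sup>2 = (cmod (c \<alpha>) * (1 / sqrt 2) ^ d)\<^sup>2"
      by (simp add: c'_def)
  qed (auto simp: c'_def)
  then have eq: "L2_set (\<lambda>\<alpha>. cmod (c' \<alpha>) * (1 / sqrt 2) ^ (\<Sum>i\<in>UNIV. \<alpha> i)) D = L2_set (\<lambda>\<alpha>. cmod (c \<alpha>)) I * (1 / sqrt 2) ^ d"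
    by (simp add: L2_set_left_distrib) (simp add: L2_set_def)
  have "L2_set (\<lambda>\<alpha>. cmod (c \<alpha>)) I * (1 / sqrt 2) ^ d
     \<le> (1 + 2 * pi * real d * real (d + 1) / real M) ^ CARD('n) * tmean M (\<lambda>w. cmod (mpoly_eval I c w))"
    using hypercontractive_PiE[OF finite M, where c = c' and F = UNIV, folded D_def, unfolded eq ev]
    by (simp add: tmean_def torus_eq_PiE)
  then have "sqrt 2 ^ d * (L2_set (\<lambda>\<alpha>. cmod (c \<alpha>)) I * (1 / sqrt 2) ^ d)
     \<le> sqrt 2 ^ d * ((1 + 2 * pi * real d * real (d + 1) / real M) ^ CARD('n) * tmean M (\<lambda>w. cmod (mpoly_eval I c w)))"
    by (rule mult_left_mono) simp
  moreover have "sqrt 2 ^ d * (L2_set (\<lambda>\<alpha>. cmod (c \<alpha>)) I * (1 / sqrt 2) ^ d) = L2_set (\<lambda>\<alpha>. cmod (c \<alpha>)) I"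
    by (simp add: power_divide)
  ultimately show ?thesis by (simp add: mult.assoc)
qed

lemma mpow_constant: "mpow (\<lambda>_. t) \<alpha> = t ^ deg \<alpha>"
  by (simp add: mpow_def deg_def power_sum)

lemma mpoly_eval_single:
  assumes "finite I" "\<beta> \<in> I"
  shows "mpoly_eval I (\<lambda>\<gamma>. if \<gamma> = \<beta> then 1 else 0) z = mpow z \<beta>"
proof -
  have "mpoly_eval I (\<lambda>\<gamma>. if \<gamma> = \<beta> then 1 else 0) z = (\<Sum>\<gamma>\<in>I. if \<gamma> = \<beta> then mpow z \<beta> else 0)"
    unfolding mpoly_eval_mpow by (intro sum.cong) auto
  then show ?thesis using assms by simp
qed

lemma exponents_less:
  fixes I :: "('n::finite \<Rightarrow> nat) set"
  assumes "finite I"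
  obtains M where "0 < M" "\<And>\<beta> i. \<beta> \<in> I \<Longrightarrow> \<beta> i < M"
proof -
  have "\<beta> i < Suc (\<Sum>\<beta>\<in>I. deg \<beta>)" if "\<beta> \<in> I" for \<beta> i
    using le_deg[of \<beta> i] member_le_sum[OF that, of deg] assms by simp
  then show ?thesis using that[of "Suc (\<Sum>\<beta>\<in>I. deg \<beta>)"] by blast
qed

section \<open>Polynomials on the unit ball of a lattice norm\<close>

locale lattice_norm =
  fixes N :: "('n::finite \<Rightarrow> complex) \<Rightarrow> real"
  assumes lattice: "banach_lattice_norm N"
begin

lemma N_nonneg: "0 \<le> N z"
  and N_eq_0: "N z = 0 \<longleftrightarrow> z = (\<lambda>_. 0)"
  and N_scale: "N (\<lambda>i. a * z i) = cmod a * N z"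
  and N_triangle: "N (\<lambda>i. z i + w i) \<le> N z + N w"
  using lattice unfolding banach_lattice_norm_def by blast+

lemma N_mono: "(\<And>i. cmod (z i) \<le> cmod (w i)) \<Longrightarrow> N z \<le> N w"
  using lattice unfolding banach_lattice_norm_def by blast

lemma ball_solid: "w \<in> unit_ball N \<Longrightarrow> (\<And>i. cmod (z i) \<le> cmod (w i)) \<Longrightarrow> z \<in> unit_ball N"
  unfolding unit_ball_def using N_mono[of z w] by auto

lemma ball_torus_mult:
  "0 < M \<Longrightarrow> z \<in> unit_ball N \<Longrightarrow> w \<in> torus M \<Longrightarrow> (\<lambda>i. z i * w i) \<in> unit_ball N"
  by (erule ball_solid) (simp add: norm_mult norm_torus)

lemma zero_in_ball: "(\<lambda>_. 0) \<in> unit_ball N"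
  using N_eq_0[of "\<lambda>_. 0"] by (simp add: unit_ball_def)

lemma ball_nonempty: "unit_ball N \<noteq> {}"
  using zero_in_ball by blast

text \<open>By the lattice property the part of \<open>z\<close> on one coordinate has norm at most
  \<open>N z\<close>; the sum of the reciprocals is a bound common to all coordinates.\<close>

lemma ball_coordinate_bound:
  obtains R where "\<And>z i. z \<in> unit_ball N \<Longrightarrow> cmod (z i) \<le> R"
proof -
  define e where "e = (\<lambda>(i::'n) j. if j = i then 1 else 0 :: complex)"
  have pos: "0 < N (e i)" for i
  proof -
    have "e i \<noteq> (\<lambda>_. 0)" by (auto simp: e_def fun_eq_iff)
    then have "N (e i) \<noteq> 0" using N_eq_0 by blast
    then show ?thesis using N_nonneg[of "e i"] by linarith
  qed
  have "cmod (z i) \<le> (\<Sum>i\<in>UNIV. 1 / N (e i))" if z: "z \<in> unit_ball N" for z i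
  proof -
    have "cmod (z i) * N (e i) = N (\<lambda>j. z i * e i j)" by (simp add: N_scale)
    also have "\<dots> \<le> N z" by (rule N_mono) (simp add: e_def)
    also have "\<dots> < 1" using z by (simp add: unit_ball_def)
    finally have "cmod (z i) \<le> 1 / N (e i)" using pos[of i] by (simp add: field_simps)
    also have "\<dots> \<le> (\<Sum>i\<in>UNIV. 1 / N (e i))"
      using pos by (intro member_le_sum) (auto simp: less_imp_le)
    finally show ?thesis .
  qed
  then show ?thesis using that by blast
qed

text \<open>Supplies a point of the ball without zero coordinates; the torus through it lies in the
  ball and detects every coefficient.\<close>

lemma ball_contains_constant:
  obtains r where "0 < r" "(\<lambda>_. complex_of_real r) \<in> unit_ball N"
proof -
  define r where "r = 1 / (2 * (N (\<lambda>_. 1) + 1))"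
  have n0: "0 \<le> N (\<lambda>_. 1)" by (rule N_nonneg)
  then have r0: "0 < r" by (simp add: r_def)
  have "N (\<lambda>_. complex_of_real r) = r * N (\<lambda>_. 1)"
    using N_scale[of "complex_of_real r" "\<lambda>_. 1"] r0 by simp
  also have "\<dots> < 1" using n0 by (simp add: r_def divide_less_eq)
  finally show ?thesis using that[OF r0] by (simp add: unit_ball_def)
qed

lemma bounded_mpow: obtains R where "0 \<le> R" "\<And>z. z \<in> unit_ball N \<Longrightarrow> cmod (mpow z \<alpha>) \<le> R"
proof -
  obtain R where R: "\<And>z i. z \<in> unit_ball N \<Longrightarrow> cmod (z i) \<le> R"
    using ball_coordinate_bound by blast
  have *: "cmod (mpow z \<alpha>) \<le> (\<Prod>i\<in>UNIV. R ^ \<alpha> i)" if "z \<in> unit_ball N" for z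
    unfolding norm_mpow using R[OF that] by (intro prod_mono) (auto intro: power_mono)
  show ?thesis by (rule that[OF _ *]) (use *[OF zero_in_ball] in \<open>auto intro: order.trans[OF norm_ge_zero]\<close>)
qed

lemma bdd_above_mpoly_eval: "bdd_above ((\<lambda>z. cmod (mpoly_eval I c z)) ` unit_ball N)"
proof -
  have "\<forall>\<alpha>. \<exists>R. \<forall>z\<in>unit_ball N. cmod (mpow z \<alpha>) \<le> R"
    using bounded_mpow by metis
  then obtain R where R: "\<And>\<alpha> z. z \<in> unit_ball N \<Longrightarrow> cmod (mpow z \<alpha>) \<le> R \<alpha>" by metis
  have "cmod (mpoly_eval I c z) \<le> (\<Sum>\<alpha>\<in>I. cmod (c \<alpha>) * R \<alpha>)" if "z \<in> unit_ball N" for z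
    unfolding mpoly_eval_mpow
    by (rule order.trans[OF norm_sum], intro sum_mono) (auto simp: norm_mult intro!: mult_left_mono R that)
  then show ?thesis by (intro bdd_aboveI2) auto
qed

lemma mpoly_eval_le_psup: "z \<in> unit_ball N \<Longrightarrow> cmod (mpoly_eval I c z) \<le> psup N I c"
  unfolding psup_def by (rule cSUP_upper[OF _ bdd_above_mpoly_eval])

lemma psup_le: "(\<And>z. z \<in> unit_ball N \<Longrightarrow> cmod (mpoly_eval I c z) \<le> C) \<Longrightarrow> psup N I c \<le> C"
  unfolding psup_def by (rule cSUP_least[OF ball_nonempty])

lemma psup_nonneg: "0 \<le> psup N I c"
  using order.trans[OF norm_ge_zero mpoly_eval_le_psup[OF zero_in_ball]] .

lemma linf_le_supnorm: "f \<in> linf_ball N \<Longrightarrow> z \<in> unit_ball N \<Longrightarrow> cmod (f z) \<le> supnorm N f"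
  unfolding supnorm_def linf_ball_def by (intro cSUP_upper) auto

lemma supnorm_le: "(\<And>z. z \<in> unit_ball N \<Longrightarrow> cmod (f z) \<le> C) \<Longrightarrow> supnorm N f \<le> C"
  unfolding supnorm_def by (rule cSUP_least[OF ball_nonempty])

lemma linf_ballI:
  "(\<And>z. z \<in> unit_ball N \<Longrightarrow> cmod (f z) \<le> C) \<Longrightarrow> (\<And>z. z \<notin> unit_ball N \<Longrightarrow> f z = 0) \<Longrightarrow> f \<in> linf_ball N"
  unfolding linf_ball_def by (auto intro!: bdd_aboveI2)

lemma linf_ball_0: "(\<lambda>z. 0) \<in> linf_ball N"
  by (rule linf_ballI[of _ 0]) auto

lemma linf_ball_add:
  assumes "f \<in> linf_ball N" "g \<in> linf_ball N"
  shows "(\<lambda>z. f z + g z) \<in> linf_ball N"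
proof (rule linf_ballI)
  show "cmod (f z + g z) \<le> supnorm N f + supnorm N g" if "z \<in> unit_ball N" for z
    using linf_le_supnorm[OF assms(1) that] linf_le_supnorm[OF assms(2) that]
      norm_triangle_ineq[of "f z" "g z"] by linarith
qed (use assms in \<open>auto simp: linf_ball_def\<close>)

lemma linf_ball_scale:
  assumes "f \<in> linf_ball N"
  shows "(\<lambda>z. a * f z) \<in> linf_ball N"
proof (rule linf_ballI)
  show "cmod (a * f z) \<le> cmod a * supnorm N f" if "z \<in> unit_ball N" for z
    using linf_le_supnorm[OF assms(1) that] by (simp add: norm_mult mult_left_mono)
qed (use assms in \<open>auto simp: linf_ball_def\<close>)

lemma linf_ball_sum:
  "(\<And>p. p \<in> T \<Longrightarrow> f p \<in> linf_ball N) \<Longrightarrow> (\<lambda>z. \<Sum>p\<in>T. f p z) \<in> linf_ball N"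
  by (induction T rule: infinite_finite_induct) (auto intro: linf_ball_0 linf_ball_add)

text \<open>Elements of \<open>linf_ball\<close> vanish off the ball, so polynomials enter that
  space only after this cut-off.\<close>

definition restr :: "(('n \<Rightarrow> complex) \<Rightarrow> complex) \<Rightarrow> ('n \<Rightarrow> complex) \<Rightarrow> complex" where
  "restr f z = (if z \<in> unit_ball N then f z else 0)"

lemma polyfuns_iff: "f \<in> polyfuns N I \<longleftrightarrow> (\<exists>c. f = restr (mpoly_eval I c))"
  unfolding polyfuns_def by (auto simp: fun_eq_iff restr_def)

lemma restr_mpoly_eval_linf: "restr (mpoly_eval I c) \<in> linf_ball N"
  by (rule linf_ballI[of _ "psup N I c"]) (auto simp: restr_def mpoly_eval_le_psup)

lemma supnorm_restr_mpoly_eval: "supnorm N (restr (mpoly_eval I c)) = psup N I c"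
  unfolding supnorm_def psup_def by (intro SUP_cong) (auto simp: restr_def)

lemma restr_mpow_polyfun: "finite I \<Longrightarrow> \<beta> \<in> I \<Longrightarrow> restr (\<lambda>z. mpow z \<beta>) \<in> polyfuns N I"
  unfolding polyfuns_iff
  by (intro exI[of _ "\<lambda>\<gamma>. if \<gamma> = \<beta> then 1 else 0"] ext) (simp add: restr_def mpoly_eval_single)

end

section \<open>Cauchy estimates and homogeneous parts\<close>

text \<open>The coefficient of a polynomial of degree at most \<open>d\<close> is recovered exactly
  by a mean over \<open>d + 1\<close> points of the circle of radius \<open>\<rho>\<close>, so no
  contour integral is involved.\<close>

lemma cauchy_estimate:
  fixes a :: "nat \<Rightarrow> complex"
  assumes "0 \<le> \<rho>" "j \<le> d" and le: "\<And>t. cmod t = \<rho> \<Longrightarrow> cmod (\<Sum>i\<le>d. a i * t ^ i) \<le> C"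
  shows "cmod (a j) * \<rho> ^ j \<le> C"
proof -
  have "cmod (a j * of_real \<rho> ^ j) \<le> umean (Suc d) (\<lambda>w. cmod (\<Sum>i\<le>d. (a i * of_real \<rho> ^ i) * w ^ i))"
    by (rule norm_coeff_le_umean) (use assms in auto)
  also have "\<dots> \<le> umean (Suc d) (\<lambda>w. C)"
  proof (rule umean_mono)
    fix w assume "w \<in> uroots (Suc d)"
    then have "cmod (of_real \<rho> * w) = \<rho>" using assms(1) norm_uroots[of "Suc d" w] by (simp add: norm_mult)
    from le[OF this] show "cmod (\<Sum>i\<le>d. (a i * of_real \<rho> ^ i) * w ^ i) \<le> C"
      by (simp add: power_mult_distrib mult_ac)
  qed
  also have "\<dots> = C" by (simp add: umean_const)
  finally show ?thesis using assms(1) by (simp add: norm_mult norm_power)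
qed

lemma mpoly_eval_homogeneous_parts:
  fixes J :: "('n::finite \<Rightarrow> nat) set"
  assumes degJ: "\<forall>\<alpha>\<in>J. deg \<alpha> \<le> m"
  shows "mpoly_eval J c (\<lambda>i. t * z i) = (\<Sum>k\<le>m. mpoly_eval (J \<inter> Lambda k) c z * t ^ k)"
proof -
  have finJ: "finite J" using degJ by (intro finite_subset[OF _ finite_deg_le[of m]]) auto
  have "(\<Sum>k\<le>m. mpoly_eval (J \<inter> Lambda k) c z * t ^ k)
      = (\<Sum>k\<le>m. \<Sum>\<alpha>\<in>{\<alpha>\<in>J. deg \<alpha> = k}. c \<alpha> * (t ^ deg \<alpha> * mpow z \<alpha>))"
    unfolding mpoly_eval_mpow Lambda_def Int_def
    by (intro sum.cong refl) (auto simp: sum_distrib_left sum_distrib_right mult_ac intro!: sum.cong)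
  also have "\<dots> = (\<Sum>\<alpha>\<in>J. c \<alpha> * (t ^ deg \<alpha> * mpow z \<alpha>))"
    using degJ by (intro sum.group finJ) auto
  finally show ?thesis by (simp add: mpoly_eval_mpow mpow_const_mult)
qed

lemma mpoly_eval_decompose:
  fixes J :: "('n::finite \<Rightarrow> nat) set"
  assumes "\<forall>\<alpha>\<in>J. deg \<alpha> \<le> m"
  shows "mpoly_eval J c z = (\<Sum>k\<le>m. mpoly_eval (J \<inter> Lambda k) c z)"
  using mpoly_eval_homogeneous_parts[OF assms, of c 1 z] by simp

text \<open>The \<open>k\<close>-th part at \<open>z\<close> is the coefficient of
  \<open>t ^ k\<close> in \<open>f (t * z)\<close>, and \<open>t * z\<close> stays in the ball for
  unimodular \<open>t\<close>.\<close>

lemma (in lattice_norm) psup_homogeneous_part_le: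
  assumes degJ: "\<forall>\<alpha>\<in>J. deg \<alpha> \<le> m" and k: "k \<le> m"
  shows "psup N (J \<inter> Lambda k) c \<le> psup N J c"
proof (rule psup_le)
  fix z assume z: "z \<in> unit_ball N"
  have "cmod (mpoly_eval (J \<inter> Lambda k) c z) * 1 ^ k \<le> psup N J c"
  proof (rule cauchy_estimate[OF _ k])
    fix t assume "cmod t = 1"
    then have "(\<lambda>i. t * z i) \<in> unit_ball N" by (intro ball_solid[OF z]) (simp add: norm_mult)
    then show "cmod (\<Sum>k\<le>m. mpoly_eval (J \<inter> Lambda k) c z * t ^ k) \<le> psup N J c"
      unfolding mpoly_eval_homogeneous_parts[OF degJ, symmetric] by (rule mpoly_eval_le_psup)
  qed simp
  then show "cmod (mpoly_eval (J \<inter> Lambda k) c z) \<le> psup N J c" by simp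
qed

section \<open>Gradients of homogeneous polynomials\<close>

text \<open>The formal partial derivative in direction \<open>k\<close>. Truncated subtraction is
  harmless: where \<open>\<alpha> k = 0\<close> the factor \<open>of_nat (\<alpha> k)\<close>
  vanishes.\<close>

definition mpderiv :: "('n::finite \<Rightarrow> nat) set \<Rightarrow> (('n \<Rightarrow> nat) \<Rightarrow> complex) \<Rightarrow> 'n \<Rightarrow> ('n \<Rightarrow> complex) \<Rightarrow> complex" where
  "mpderiv J c k z = (\<Sum>\<alpha>\<in>J. c \<alpha> * (of_nat (\<alpha> k) * mpow z (\<alpha>(k := \<alpha> k - 1))))"

lemma deg_upd: "deg (\<alpha>(k := j)) + \<alpha> k = deg \<alpha> + j" for \<alpha> :: "'n::finite \<Rightarrow> nat"
proof -
  have "deg (\<alpha>(k := j)) = j + (\<Sum>i\<in>UNIV - {k}. \<alpha> i)"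
    unfolding deg_def by (subst sum.remove[of _ k]) (auto intro!: sum.cong)
  moreover have "deg \<alpha> = \<alpha> k + (\<Sum>i\<in>UNIV - {k}. \<alpha> i)"
    unfolding deg_def by (subst sum.remove[of _ k]) auto
  ultimately show ?thesis by simp
qed

text \<open>The polynomial is the monomial along the line \<open>z + t * v\<close>. Its linear
  coefficient is its derivative at 0, computed by the product rule.\<close>

lemma coeff_1_mpow_line:
  fixes z v :: "'n::finite \<Rightarrow> complex"
  shows "poly.coeff (\<Prod>i\<in>UNIV. [:z i, v i:] ^ \<alpha> i) 1
    = (\<Sum>k\<in>UNIV. v k * (of_nat (\<alpha> k) * mpow z (\<alpha>(k := \<alpha> k - 1))))"
proof -
  define Q where "Q = (\<Prod>i\<in>UNIV. [:z i, v i:] ^ \<alpha> i)"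
  have "poly.coeff Q 1 = poly (pderiv Q) 0"
    by (simp add: poly_0_coeff_0 coeff_pderiv)
  also have "\<dots> = (\<Sum>k\<in>UNIV. (\<Prod>i\<in>UNIV - {k}. z i ^ \<alpha> i) * (of_nat (\<alpha> k) * z k ^ (\<alpha> k - 1) * v k))"
    unfolding Q_def pderiv_prod poly_sum
    by (intro sum.cong refl)
       (simp add: poly_prod pderiv_power pderiv_pCons)
  also have "\<dots> = (\<Sum>k\<in>UNIV. v k * (of_nat (\<alpha> k) * mpow z (\<alpha>(k := \<alpha> k - 1))))"
  proof (intro sum.cong refl)
    fix k
    have "mpow z (\<alpha>(k := \<alpha> k - 1)) = z k ^ (\<alpha> k - 1) * (\<Prod>i\<in>UNIV - {k}. z i ^ \<alpha> i)"
      unfolding mpow_def by (subst prod.remove[of _ k]) (auto intro!: prod.cong)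
    then show "(\<Prod>i\<in>UNIV - {k}. z i ^ \<alpha> i) * (of_nat (\<alpha> k) * z k ^ (\<alpha> k - 1) * v k)
      = v k * (of_nat (\<alpha> k) * mpow z (\<alpha>(k := \<alpha> k - 1)))" by simp
  qed
  finally show ?thesis unfolding Q_def .
qed

text \<open>For \<open>m > 1\<close> the base is the reciprocal of \<open>1 + 1 / (m - 1)\<close>,
  to which \<open>1 + x \<le> exp x\<close> applies; for \<open>m = 1\<close> the power is
  1.\<close>

lemma exp_minus_1_le: "exp (- 1) \<le> (1 - 1 / real m) ^ (m - 1)" if "1 \<le> m"
proof (cases "m = 1")
  case False
  then have m: "2 \<le> m" using that by simp
  have r: "real (m - 1) = real m - 1" using m by simp
  have "(1 + 1 / (real m - 1)) ^ (m - 1) \<le> exp (1 / (real m - 1)) ^ (m - 1)"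
    using m by (intro power_mono exp_ge_add_one_self) auto
  also have "\<dots> = exp 1" using m r by (simp flip: exp_of_nat_mult)
  finally have *: "(1 + 1 / (real m - 1)) ^ (m - 1) \<le> exp 1" .
  have "(1 - 1 / real m) * (1 + 1 / (real m - 1)) = 1" using m by (simp add: field_simps)
  then have "(1 - 1 / real m) ^ (m - 1) * (1 + 1 / (real m - 1)) ^ (m - 1) = 1"
    by (simp add: power_mult_distrib[symmetric])
  moreover have "(1 - 1 / real m) ^ (m - 1) * (1 + 1 / (real m - 1)) ^ (m - 1) \<le> (1 - 1 / real m) ^ (m - 1) * exp 1"
    using m by (intro mult_left_mono *) auto
  ultimately show ?thesis by (simp add: exp_minus field_simps)
qed simp

text \<open>By convexity \<open>s * z + t * v\<close> lies in the ball for
  \<open>\<bar>t\<bar> = 1 - s\<close>. The linear coefficient in \<open>t\<close> is, by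
  homogeneity, \<open>s ^ (m - 1)\<close> times the derivative at \<open>z\<close> along
  \<open>v\<close>, and the Cauchy estimate bounds it.\<close>

lemma (in lattice_norm) directional_derivative_bound:
  assumes m: "1 \<le> m" and J: "J \<subseteq> Lambda m" and z: "z \<in> unit_ball N" and v: "v \<in> unit_ball N"
  shows "cmod (\<Sum>k\<in>UNIV. v k * mpderiv J c k z) \<le> exp 1 * real m * psup N J c"
proof -
  \<comment> \<open>This value maximizes \<open>s ^ (m - 1) * (1 - s)\<close>; the resulting
    constant \<open>m / s ^ (m - 1)\<close> is at most \<open>exp 1 * m\<close>.\<close>
  define s where "s = 1 - 1 / real m"
  have s: "0 \<le> s" "s + 1 / real m = 1" using m by (auto simp: s_def)
  define Q where "Q = (\<lambda>\<alpha>. \<Prod>i\<in>UNIV. [:of_real s * z i, v i:] ^ \<alpha> i)"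
  define P where "P = (\<Sum>\<alpha>\<in>J. smult (c \<alpha>) (Q \<alpha>))"
  have dJ: "deg \<alpha> = m" if "\<alpha> \<in> J" for \<alpha> using J that by (auto simp: Lambda_def)
  have "degree (Q \<alpha>) \<le> deg \<alpha>" for \<alpha>
  proof -
    have "degree ([:of_real s * z i, v i:] ^ \<alpha> i) \<le> \<alpha> i" for i
      using degree_power_le[of "[:of_real s * z i, v i:]" "\<alpha> i"] by (auto split: if_splits)
    then have "(\<Sum>i\<in>UNIV. degree ([:of_real s * z i, v i:] ^ \<alpha> i)) \<le> deg \<alpha>"
      unfolding deg_def by (intro sum_mono)
    then show ?thesis unfolding Q_def
      using degree_prod_sum_le[of UNIV "\<lambda>i. [:of_real s * z i, v i:] ^ \<alpha> i"] by (auto simp: o_def)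
  qed
  then have "degree (smult (c \<alpha>) (Q \<alpha>)) \<le> m" if "\<alpha> \<in> J" for \<alpha>
    using dJ[OF that] degree_smult_le[of "c \<alpha>" "Q \<alpha>"] by (metis order.trans)
  moreover have finJ: "finite J" using J finite_Lambda by (rule finite_subset)
  ultimately have dP: "degree P \<le> m" unfolding P_def by (intro degree_sum_le) auto
  have evP: "poly P t = mpoly_eval J c (\<lambda>i. of_real s * z i + t * v i)" for t
    unfolding P_def Q_def mpoly_eval_def by (simp add: poly_sum poly_prod algebra_simps)
  have "cmod (poly.coeff P 1) * (1 / real m) ^ 1 \<le> psup N J c"
  proof (rule cauchy_estimate[where d = m])
    fix t :: complex assume t: "cmod t = 1 / real m"
    have "N (\<lambda>i. of_real s * z i + t * v i) \<le> s * N z + 1 / real m * N v"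
      using N_triangle[of "\<lambda>i. of_real s * z i" "\<lambda>i. t * v i"] s(1)
      by (simp add: N_scale t)
    also have "\<dots> < 1"
    proof -
      have "s * N z \<le> s * 1" using z s(1) by (intro mult_left_mono) (auto simp: unit_ball_def)
      moreover have "1 / real m * N v < 1 / real m * 1"
        using v m by (intro mult_strict_left_mono) (auto simp: unit_ball_def)
      ultimately show ?thesis using s(2) by linarith
    qed
    finally show "cmod (\<Sum>i\<le>m. poly.coeff P i * t ^ i) \<le> psup N J c"
      unfolding poly_eq_sum_atMost[OF dP, symmetric] evP
      by (intro mpoly_eval_le_psup) (simp add: unit_ball_def)
  qed (use m in auto)
  moreover have "poly.coeff P 1 = of_real (s ^ (m - 1)) * (\<Sum>k\<in>UNIV. v k * mpderiv J c k z)"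
  proof -
    have key: "of_nat (\<alpha> k) * mpow (\<lambda>i. of_real s * z i) (\<alpha>(k := \<alpha> k - 1))
        = of_nat (\<alpha> k) * (of_real s ^ (m - 1) * mpow z (\<alpha>(k := \<alpha> k - 1)))" if \<alpha>: "\<alpha> \<in> J" for \<alpha> k
    proof (cases "\<alpha> k = 0")
      case False
      then have "deg (\<alpha>(k := \<alpha> k - 1)) = m - 1" using deg_upd[of \<alpha> k "\<alpha> k - 1"] dJ[OF \<alpha>] by simp
      then show ?thesis unfolding mpow_const_mult by simp
    qed simp
    have "poly.coeff P 1 = (\<Sum>\<alpha>\<in>J. c \<alpha> * (\<Sum>k\<in>UNIV. v k * (of_nat (\<alpha> k) * mpow (\<lambda>i. of_real s * z i) (\<alpha>(k := \<alpha> k - 1)))))"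
      unfolding P_def Q_def coeff_sum coeff_smult coeff_1_mpow_line ..
    also have "\<dots> = (\<Sum>\<alpha>\<in>J. c \<alpha> * (\<Sum>k\<in>UNIV. v k * (of_nat (\<alpha> k) * (of_real s ^ (m - 1) * mpow z (\<alpha>(k := \<alpha> k - 1))))))"
      by (intro sum.cong refl) (simp only: key)
    also have "\<dots> = of_real (s ^ (m - 1)) * (\<Sum>\<alpha>\<in>J. \<Sum>k\<in>UNIV. v k * (c \<alpha> * (of_nat (\<alpha> k) * mpow z (\<alpha>(k := \<alpha> k - 1)))))"
      by (simp add: sum_distrib_left mult_ac)
    also have "(\<Sum>\<alpha>\<in>J. \<Sum>k\<in>UNIV. v k * (c \<alpha> * (of_nat (\<alpha> k) * mpow z (\<alpha>(k := \<alpha> k - 1)))))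
        = (\<Sum>k\<in>UNIV. v k * mpderiv J c k z)"
      unfolding mpderiv_def sum_distrib_left by (rule sum.swap)
    finally show ?thesis .
  qed
  ultimately have A: "s ^ (m - 1) * cmod (\<Sum>k\<in>UNIV. v k * mpderiv J c k z) / real m \<le> psup N J c"
    using s(1) by (simp add: norm_mult norm_power)
  have "exp (- 1) * cmod (\<Sum>k\<in>UNIV. v k * mpderiv J c k z) \<le> s ^ (m - 1) * cmod (\<Sum>k\<in>UNIV. v k * mpderiv J c k z)"
    unfolding s_def by (intro mult_right_mono exp_minus_1_le m) simp
  also have "\<dots> \<le> real m * psup N J c" using A m by (simp add: field_simps)
  finally show ?thesis by (simp add: exp_minus field_simps)
qed

lemma cnj_sgn_mult: "cnj (sgn a) * a = of_real (cmod a)"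
proof (cases "a = 0")
  case False
  have "cnj (sgn a) * a = (a * cnj a) / of_real (cmod a)"
    by (simp add: sgn_div_norm scaleR_conv_of_real field_simps)
  also have "\<dots> = of_real (cmod a)"
    using False by (simp only: complex_norm_square[symmetric]) (simp add: power2_eq_square)
  finally show ?thesis .
qed simp

text \<open>The dual lattice norm of the gradient: solidity of the ball allows the phases of the
  direction to be aligned with those of the partial derivatives.\<close>

lemma (in lattice_norm) gradient_bound:
  assumes m: "1 \<le> m" and J: "J \<subseteq> Lambda m" and z: "z \<in> unit_ball N" and y: "y \<in> unit_ball N"
  shows "(\<Sum>k\<in>UNIV. cmod (y k) * cmod (mpderiv J c k z)) \<le> exp 1 * real m * psup N J c"
proof -
  define v where "v = (\<lambda>k. of_real (cmod (y k)) * cnj (sgn (mpderiv J c k z)))"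
  have "cmod (v k) \<le> cmod (y k)" for k by (simp add: v_def norm_mult norm_sgn)
  then have "v \<in> unit_ball N" by (rule ball_solid[OF y])
  from directional_derivative_bound[OF m J z this, of c]
  have "cmod (\<Sum>k\<in>UNIV. v k * mpderiv J c k z) \<le> exp 1 * real m * psup N J c" .
  moreover have "v k * mpderiv J c k z = of_real (cmod (y k) * cmod (mpderiv J c k z))" for k
    by (simp add: v_def mult.assoc cnj_sgn_mult)
  then have "(\<Sum>k\<in>UNIV. v k * mpderiv J c k z) = of_real (\<Sum>k\<in>UNIV. cmod (y k) * cmod (mpderiv J c k z))"
    by simp
  ultimately show ?thesis by (simp add: sum_nonneg norm_of_real del: of_real_sum)
qed

section \<open>Functionals on bounded functions\<close>

context lattice_norm
begin

text \<open>Linearity is demanded only on \<open>linf_ball\<close>, since a projection is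
  unconstrained on other functions.\<close>

definition linf_linear :: "((('n \<Rightarrow> complex) \<Rightarrow> complex) \<Rightarrow> complex) \<Rightarrow> bool" where
  "linf_linear \<psi> \<longleftrightarrow>
     (\<forall>f\<in>linf_ball N. \<forall>g\<in>linf_ball N. \<psi> (\<lambda>z. f z + g z) = \<psi> f + \<psi> g) \<and>
     (\<forall>f\<in>linf_ball N. \<forall>a. \<psi> (\<lambda>z. a * f z) = a * \<psi> f)"

lemma linf_linear_add:
  "linf_linear \<psi> \<Longrightarrow> f \<in> linf_ball N \<Longrightarrow> g \<in> linf_ball N \<Longrightarrow> \<psi> (\<lambda>z. f z + g z) = \<psi> f + \<psi> g"
  by (simp add: linf_linear_def)

lemma linf_linear_scale: "linf_linear \<psi> \<Longrightarrow> f \<in> linf_ball N \<Longrightarrow> \<psi> (\<lambda>z. a * f z) = a * \<psi> f"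
  by (simp add: linf_linear_def)

lemma linf_linear_sum:
  assumes "linf_linear \<psi>" "\<And>p. p \<in> T \<Longrightarrow> f p \<in> linf_ball N"
  shows "\<psi> (\<lambda>z. \<Sum>p\<in>T. a p * f p z) = (\<Sum>p\<in>T. a p * \<psi> (f p))"
proof -
  have 0: "\<psi> (\<lambda>z. 0) = 0"
    using linf_linear_scale[OF assms(1) linf_ball_0, of 0] by simp
  show ?thesis using assms(2)
  proof (induction T rule: infinite_finite_induct)
    case (infinite T)
    show ?case by (simp only: sum.infinite[OF infinite(1)] 0)
  next
    case empty
    show ?case by (simp only: sum.empty 0)
  next
    case (insert p T)
    have "\<psi> (\<lambda>z. a p * f p z + (\<Sum>p\<in>T. a p * f p z)) = \<psi> (\<lambda>z. a p * f p z) + \<psi> (\<lambda>z. \<Sum>p\<in>T. a p * f p z)"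
      using insert.prems by (intro linf_linear_add[OF assms(1)] linf_ball_sum linf_ball_scale) auto
    also have "\<psi> (\<lambda>z. a p * f p z) = a p * \<psi> (f p)"
      using insert.prems by (intro linf_linear_scale[OF assms(1)]) auto
    also have "\<psi> (\<lambda>z. \<Sum>p\<in>T. a p * f p z) = (\<Sum>p\<in>T. a p * \<psi> (f p))"
      using insert.prems by (intro insert.IH) auto
    finally show ?case by (simp only: sum.insert[OF insert.hyps])
  qed
qed

text \<open>Points are sorted by the grid squares of side \<open>\<delta>\<close> that contain the
  values of the monomials from \<open>I\<close>. The monomials are bounded, so finitely many labels
  occur; real and imaginary parts each contribute one \<open>\<delta>\<close> to the error.\<close>

lemma ball_partition:
  assumes "finite I" and \<delta>: "0 < \<delta>"
  obtains T :: "(('n \<Rightarrow> nat) \<Rightarrow> int \<times> int) set" and l rep where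
    "finite T" "\<And>z. z \<in> unit_ball N \<Longrightarrow> l z \<in> T"
    "\<And>p. p \<in> T \<Longrightarrow> rep p \<in> unit_ball N"
    "\<And>z \<beta>. z \<in> unit_ball N \<Longrightarrow> \<beta> \<in> I \<Longrightarrow> cmod (mpow z \<beta> - mpow (rep (l z)) \<beta>) \<le> 2 * \<delta>"
proof -
  \<comment> \<open>Restriction to \<open>I\<close> makes the labels extensional, so that they lie
    in a finite \<open>PiE\<close>.\<close>
  define l where "l = (\<lambda>z. \<lambda>\<beta>\<in>I. (\<lfloor>Re (mpow z \<beta>) / \<delta>\<rfloor>, \<lfloor>Im (mpow z \<beta>) / \<delta>\<rfloor>))"
  define T where "T = l ` unit_ball N"
  define rep where "rep = (\<lambda>p. SOME z. z \<in> unit_ball N \<and> l z = p)"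
  have rep: "rep p \<in> unit_ball N \<and> l (rep p) = p" if "p \<in> T" for p
    unfolding rep_def by (rule someI_ex[of "\<lambda>z. z \<in> unit_ball N \<and> l z = p"]) (use that in \<open>auto simp: T_def\<close>)
  have "\<forall>\<beta>. \<exists>R. \<forall>z\<in>unit_ball N. cmod (mpow z \<beta>) \<le> R" using bounded_mpow by metis
  then obtain R where R: "\<And>\<beta> z. z \<in> unit_ball N \<Longrightarrow> cmod (mpow z \<beta>) \<le> R \<beta>" by metis
  define K where "K = (\<lambda>\<beta>. {\<lfloor>- R \<beta> / \<delta>\<rfloor>..\<lfloor>R \<beta> / \<delta>\<rfloor>})"
  have fl: "\<lfloor>x / \<delta>\<rfloor> \<in> K \<beta>" if "\<bar>x\<bar> \<le> R \<beta>" for x \<beta>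
  proof -
    have "- R \<beta> / \<delta> \<le> x / \<delta>" "x / \<delta> \<le> R \<beta> / \<delta>"
      using that \<delta> by (intro divide_right_mono; linarith)+
    then show ?thesis unfolding K_def by (simp add: floor_mono)
  qed
  have "T \<subseteq> PiE I (\<lambda>\<beta>. K \<beta> \<times> K \<beta>)"
  proof
    fix p assume "p \<in> T"
    then obtain z where z: "z \<in> unit_ball N" "p = l z" by (auto simp: T_def)
    have "\<bar>Re (mpow z \<beta>)\<bar> \<le> R \<beta>" "\<bar>Im (mpow z \<beta>)\<bar> \<le> R \<beta>" for \<beta>
      using R[OF z(1), of \<beta>] abs_Re_le_cmod[of "mpow z \<beta>"] abs_Im_le_cmod[of "mpow z \<beta>"] by linarith+
    then show "p \<in> PiE I (\<lambda>\<beta>. K \<beta> \<times> K \<beta>)" unfolding z(2) l_def using fl by auto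
  qed
  moreover have "finite (PiE I (\<lambda>\<beta>. K \<beta> \<times> K \<beta>))"
    using assms(1) by (intro finite_PiE) (auto simp: K_def)
  ultimately have fin: "finite T" by (rule finite_subset)
  have flo: "\<bar>x - y\<bar> \<le> \<delta>" if "\<lfloor>x / \<delta>\<rfloor> = \<lfloor>y / \<delta>\<rfloor>" for x y
  proof -
    have "\<bar>x / \<delta> - y / \<delta>\<bar> \<le> 1" using that floor_correct[of "x / \<delta>"] floor_correct[of "y / \<delta>"] by linarith
    moreover have "x / \<delta> - y / \<delta> = (x - y) / \<delta>" by (simp add: diff_divide_distrib)
    ultimately show ?thesis using \<delta> by simp
  qed
  show ?thesis
  proof (rule that[OF fin])
    show lT: "l z \<in> T" if "z \<in> unit_ball N" for z using that by (simp add: T_def)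
    show "rep p \<in> unit_ball N" if "p \<in> T" for p using rep[OF that] by blast
    fix z \<beta> assume z: "z \<in> unit_ball N" and \<beta>: "\<beta> \<in> I"
    have "l (rep (l z)) = l z" using rep[OF lT[OF z]] by blast
    then have "l (rep (l z)) \<beta> = l z \<beta>" by simp
    then have "\<lfloor>Re (mpow z \<beta>) / \<delta>\<rfloor> = \<lfloor>Re (mpow (rep (l z)) \<beta>) / \<delta>\<rfloor>" "\<lfloor>Im (mpow z \<beta>) / \<delta>\<rfloor> = \<lfloor>Im (mpow (rep (l z)) \<beta>) / \<delta>\<rfloor>"
      using \<beta> unfolding l_def by auto
    from flo[OF this(1)] flo[OF this(2)] cmod_le[of "mpow z \<beta> - mpow (rep (l z)) \<beta>"]
    show "cmod (mpow z \<beta> - mpow (rep (l z)) \<beta>) \<le> 2 * \<delta>" by simp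
  qed
qed

text \<open>Let \<open>\<Psi>\<^sub>w\<close> denote the functional \<open>h \<mapsto> \<Sum>\<^sub>\<beta> \<psi>\<^sub>\<beta>(h) w\<^sup>\<beta>\<close>. On functions that are constant on the
  cells of a finite partition the functionals are vectors, and Cauchy--Schwarz in \<open>\<beta>\<close> on each cell
  reduces the claim to the mean over \<open>w\<close> of the total variation of \<open>\<Psi>\<^sub>w\<close>, which is at most \<open>K\<close>.\<close>

lemma diagonal_functional_bound:
  fixes \<psi> :: "('n \<Rightarrow> nat) \<Rightarrow> (('n \<Rightarrow> complex) \<Rightarrow> complex) \<Rightarrow> complex"
  assumes fin: "finite I" and M: "0 < M" and K: "0 \<le> K" and C: "0 \<le> C" 
    and lin: "\<And>\<beta>. linf_linear (\<psi> \<beta>)"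
    and each: "\<And>\<beta> h. \<beta> \<in> I \<Longrightarrow> h \<in> linf_ball N \<Longrightarrow> cmod (\<psi> \<beta> h) \<le> K * supnorm N h"
    and joint: "\<And>w h. w \<in> torus M \<Longrightarrow> h \<in> linf_ball N \<Longrightarrow> cmod (\<Sum>\<beta>\<in>I. \<psi> \<beta> h * mpow w \<beta>) \<le> K * supnorm N h"
    and hyp: "\<And>c. L2_set (\<lambda>\<beta>. cmod (c \<beta>)) I \<le> C * tmean M (\<lambda>w. cmod (mpoly_eval I c w))"
    and S: "\<And>z. z \<in> unit_ball N \<Longrightarrow> L2_set (\<lambda>\<beta>. cmod (b \<beta> * mpow z \<beta>)) I \<le> S"
  shows "cmod (\<Sum>\<beta>\<in>I. b \<beta> * \<psi> \<beta> (restr (\<lambda>z. mpow z \<beta>))) \<le> S * C * K"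
proof -
  have S0: "0 \<le> S" using order.trans[OF L2_set_nonneg S[OF zero_in_ball]] .
  define W where "W = (\<Sum>\<beta>\<in>I. cmod (b \<beta>))"
  have W0: "0 \<le> W" by (simp add: W_def sum_nonneg)
  have approx: "cmod (\<Sum>\<beta>\<in>I. b \<beta> * \<psi> \<beta> (restr (\<lambda>z. mpow z \<beta>))) \<le> S * C * K + W * (K * (2 * \<delta>))"
    if \<delta>: "0 < \<delta>" for \<delta>
  proof -
    obtain T :: "(('n \<Rightarrow> nat) \<Rightarrow> int \<times> int) set" and l rep where
      T: "finite T" and lT: "\<And>z. z \<in> unit_ball N \<Longrightarrow> l z \<in> T" and
      rep: "\<And>p. p \<in> T \<Longrightarrow> rep p \<in> unit_ball N" and
      close: "\<And>z \<beta>. z \<in> unit_ball N \<Longrightarrow> \<beta> \<in> I \<Longrightarrow> cmod (mpow z \<beta> - mpow (rep (l z)) \<beta>) \<le> 2 * \<delta>"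
      using ball_partition[OF fin \<delta>] by metis
    define ind where "ind = (\<lambda>p. restr (\<lambda>z. if l z = p then 1 else 0))"
    have ind: "ind p \<in> linf_ball N" for p
      by (rule linf_ballI[of _ 1]) (auto simp: ind_def restr_def)
    have sum_ind: "(\<Sum>p\<in>T. a p * ind p z) = restr (\<lambda>z. a (l z)) z" for a z
    proof (cases "z \<in> unit_ball N")
      case True
      then have "(\<Sum>p\<in>T. a p * ind p z) = (\<Sum>p\<in>T. if l z = p then a p else 0)"
        by (intro sum.cong) (auto simp: ind_def restr_def)
      then show ?thesis using lT[OF True] T True by (simp add: restr_def)
    qed (simp add: ind_def restr_def)
    \<comment> \<open>The monomial is split into a step function, with its values at the
      representatives, and a remainder of sup norm at most \<open>2 * \<delta>\<close>.\<close>
    have app: "\<psi> \<beta> (restr (\<lambda>z. mpow z \<beta>)) = (\<Sum>p\<in>T. mpow (rep p) \<beta> * \<psi> \<beta> (ind p))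
        + \<psi> \<beta> (restr (\<lambda>z. mpow z \<beta> - mpow (rep (l z)) \<beta>))" if \<beta>: "\<beta> \<in> I" for \<beta>
    proof -
      have "restr (\<lambda>z. mpow z \<beta>) = (\<lambda>z. (\<Sum>p\<in>T. mpow (rep p) \<beta> * ind p z) + restr (\<lambda>z. mpow z \<beta> - mpow (rep (l z)) \<beta>) z)"
        unfolding sum_ind by (auto simp: restr_def)
      moreover have "restr (\<lambda>z. mpow z \<beta> - mpow (rep (l z)) \<beta>) \<in> linf_ball N"
        using close[OF _ \<beta>] by (intro linf_ballI[of _ "2 * \<delta>"]) (auto simp: restr_def)
      ultimately have "\<psi> \<beta> (restr (\<lambda>z. mpow z \<beta>)) = \<psi> \<beta> (\<lambda>z. \<Sum>p\<in>T. mpow (rep p) \<beta> * ind p z)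
          + \<psi> \<beta> (restr (\<lambda>z. mpow z \<beta> - mpow (rep (l z)) \<beta>))"
        by (simp only:) (intro linf_linear_add[OF lin] linf_ball_sum linf_ball_scale ind)
      then show ?thesis using linf_linear_sum[OF lin, of T ind] ind by simp
    qed
    have err: "cmod (\<psi> \<beta> (restr (\<lambda>z. mpow z \<beta> - mpow (rep (l z)) \<beta>))) \<le> K * (2 * \<delta>)" if \<beta>: "\<beta> \<in> I" for \<beta>
    proof -
      have "restr (\<lambda>z. mpow z \<beta> - mpow (rep (l z)) \<beta>) \<in> linf_ball N"
        using close[OF _ \<beta>] by (intro linf_ballI[of _ "2 * \<delta>"]) (auto simp: restr_def)
      from each[OF \<beta> this] show ?thesis
        by (rule order.trans) (intro mult_left_mono K supnorm_le, simp add: restr_def close \<beta>)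
    qed
    \<comment> \<open>Total variation: with the phases \<open>\<theta>\<close> the step function
      \<open>h\<close> has sup norm at most 1, and the functional at \<open>w\<close> maps it to the
      sum in question.\<close>
    have tv: "(\<Sum>p\<in>T. cmod (\<Sum>\<beta>\<in>I. \<psi> \<beta> (ind p) * mpow w \<beta>)) \<le> K" if w: "w \<in> torus M" for w
    proof -
      define \<theta> where "\<theta> = (\<lambda>p. cnj (sgn (\<Sum>\<beta>\<in>I. \<psi> \<beta> (ind p) * mpow w \<beta>)))"
      define h where "h = (\<lambda>z. \<Sum>p\<in>T. \<theta> p * ind p z)"
      have hl: "h \<in> linf_ball N" unfolding h_def by (intro linf_ball_sum linf_ball_scale ind)
      define V where "V = (\<Sum>p\<in>T. cmod (\<Sum>\<beta>\<in>I. \<psi> \<beta> (ind p) * mpow w \<beta>))"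
      have V0: "0 \<le> V" unfolding V_def by (intro sum_nonneg norm_ge_zero)
      have "of_real V = (\<Sum>p\<in>T. \<theta> p * (\<Sum>\<beta>\<in>I. \<psi> \<beta> (ind p) * mpow w \<beta>))"
        by (simp add: V_def \<theta>_def cnj_sgn_mult)
      also have "\<dots> = (\<Sum>\<beta>\<in>I. (\<Sum>p\<in>T. \<theta> p * \<psi> \<beta> (ind p)) * mpow w \<beta>)"
        unfolding sum_distrib_left sum_distrib_right by (subst sum.swap) (simp add: mult_ac)
      also have "\<dots> = (\<Sum>\<beta>\<in>I. \<psi> \<beta> h * mpow w \<beta>)"
        unfolding h_def using linf_linear_sum[OF lin, of T ind] ind by simp
      finally have "cmod (of_real V) = cmod (\<Sum>\<beta>\<in>I. \<psi> \<beta> h * mpow w \<beta>)"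
        by (rule arg_cong)
      then have "V = cmod (\<Sum>\<beta>\<in>I. \<psi> \<beta> h * mpow w \<beta>)"
        using V0 by simp
      also have "\<dots> \<le> K * supnorm N h" by (rule joint[OF w hl])
      also have "\<dots> \<le> K * 1"
      proof (intro mult_left_mono K supnorm_le)
        fix z assume "z \<in> unit_ball N"
        then show "cmod (h z) \<le> 1" unfolding h_def sum_ind by (simp add: restr_def \<theta>_def norm_sgn)
      qed
      finally show ?thesis by (simp add: V_def)
    qed
    have "cmod (\<Sum>\<beta>\<in>I. b \<beta> * (\<Sum>p\<in>T. mpow (rep p) \<beta> * \<psi> \<beta> (ind p))) \<le> S * C * K"
    proof -
      have "cmod (\<Sum>\<beta>\<in>I. b \<beta> * (\<Sum>p\<in>T. mpow (rep p) \<beta> * \<psi> \<beta> (ind p)))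
          = cmod (\<Sum>p\<in>T. \<Sum>\<beta>\<in>I. (b \<beta> * mpow (rep p) \<beta>) * \<psi> \<beta> (ind p))"
        unfolding sum_distrib_left by (subst sum.swap) (simp add: mult_ac)
      also have "\<dots> \<le> (\<Sum>p\<in>T. \<Sum>\<beta>\<in>I. \<bar>cmod (b \<beta> * mpow (rep p) \<beta>)\<bar> * \<bar>cmod (\<psi> \<beta> (ind p))\<bar>)"
        by (intro order.trans[OF norm_sum] sum_mono) (simp add: norm_mult)
      \<comment> \<open>On each cell \<open>S\<close> bounds the first square function at its
        representative, and hypercontractivity turns the second into a mean, which can then be
        summed over the cells.\<close>
      also have "\<dots> \<le> (\<Sum>p\<in>T. S * (C * tmean M (\<lambda>w. cmod (\<Sum>\<beta>\<in>I. \<psi> \<beta> (ind p) * mpow w \<beta>))))"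
      proof (rule sum_mono)
        fix p assume p: "p \<in> T"
        have "(\<Sum>\<beta>\<in>I. \<bar>cmod (b \<beta> * mpow (rep p) \<beta>)\<bar> * \<bar>cmod (\<psi> \<beta> (ind p))\<bar>)
            \<le> L2_set (\<lambda>\<beta>. cmod (b \<beta> * mpow (rep p) \<beta>)) I * L2_set (\<lambda>\<beta>. cmod (\<psi> \<beta> (ind p))) I"
          by (rule L2_set_mult_ineq)
        also have "\<dots> \<le> S * (C * tmean M (\<lambda>w. cmod (\<Sum>\<beta>\<in>I. \<psi> \<beta> (ind p) * mpow w \<beta>)))"
          using hyp[of "\<lambda>\<beta>. \<psi> \<beta> (ind p)"] unfolding mpoly_eval_mpow
          by (intro mult_mono S rep p S0) auto
        finally show "(\<Sum>\<beta>\<in>I. \<bar>cmod (b \<beta> * mpow (rep p) \<beta>)\<bar> * \<bar>cmod (\<psi> \<beta> (ind p))\<bar>)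
          \<le> S * (C * tmean M (\<lambda>w. cmod (\<Sum>\<beta>\<in>I. \<psi> \<beta> (ind p) * mpow w \<beta>)))" .
      qed
      also have "\<dots> = S * C * tmean M (\<lambda>w. \<Sum>p\<in>T. cmod (\<Sum>\<beta>\<in>I. \<psi> \<beta> (ind p) * mpow w \<beta>))"
        by (simp add: tmean_sum sum_distrib_left mult.assoc)
      also have "\<dots> \<le> S * C * K"
        using S0 C by (intro mult_left_mono tmean_le M tv) auto
      finally show ?thesis .
    qed
    moreover have "cmod (\<Sum>\<beta>\<in>I. b \<beta> * \<psi> \<beta> (restr (\<lambda>z. mpow z \<beta> - mpow (rep (l z)) \<beta>))) \<le> W * (K * (2 * \<delta>))"
      unfolding W_def sum_distrib_right
      by (rule order.trans[OF norm_sum], intro sum_mono) (auto simp: norm_mult intro!: mult_left_mono err)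
    moreover have "(\<Sum>\<beta>\<in>I. b \<beta> * \<psi> \<beta> (restr (\<lambda>z. mpow z \<beta>)))
      = (\<Sum>\<beta>\<in>I. b \<beta> * (\<Sum>p\<in>T. mpow (rep p) \<beta> * \<psi> \<beta> (ind p)))
        + (\<Sum>\<beta>\<in>I. b \<beta> * \<psi> \<beta> (restr (\<lambda>z. mpow z \<beta> - mpow (rep (l z)) \<beta>)))"
      unfolding sum.distrib[symmetric] by (intro sum.cong refl) (simp add: app distrib_left)
    ultimately show ?thesis by (simp only:) (intro norm_triangle_le add_mono)
  qed
  show ?thesis
  proof (rule field_le_epsilon)
    fix e :: real assume e: "0 < e"
    \<comment> \<open>Makes the error term at most \<open>e\<close>; the added 1 keeps the
      denominator positive if \<open>W * K = 0\<close>.\<close>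
    define \<delta> where "\<delta> = e / (2 * (W * K + 1))"
    have WK: "0 \<le> W * K" using W0 K by simp
    then have \<delta>: "0 < \<delta>" using e by (simp add: \<delta>_def)
    have "W * (K * (2 * \<delta>)) = e * (W * K / (W * K + 1))"
      using WK by (simp add: \<delta>_def field_simps)
    also have "\<dots> \<le> e * 1" using e WK by (intro mult_left_mono) (auto simp: divide_le_eq)
    finally show "cmod (\<Sum>\<beta>\<in>I. b \<beta> * \<psi> \<beta> (restr (\<lambda>z. mpow z \<beta>))) \<le> S * C * K + e"
      using approx[OF \<delta>] by linarith
  qed
qed

end

section \<open>Bounding the coefficients by a projection\<close>

abbreviation raise :: "('n \<Rightarrow> nat) \<Rightarrow> 'n \<Rightarrow> 'n \<Rightarrow> nat" where
  "raise \<beta> k \<equiv> (\<lambda>j. \<beta> j + unitvec k j)"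

text \<open>The substitution \<open>\<alpha> = raise \<beta> k\<close>. It reaches only exponents
  with \<open>\<alpha> k \<noteq> 0\<close>, but the factor \<open>\<alpha> k\<close> kills the
  others.\<close>

lemma sum_flat:
  fixes J :: "('n::finite \<Rightarrow> nat) set" and G :: "('n \<Rightarrow> nat) \<Rightarrow> ('n \<Rightarrow> nat) \<Rightarrow> complex"
  assumes J: "J \<subseteq> Lambda m" and m: "1 \<le> m"
  shows "(\<Sum>\<beta>\<in>flat m J. if raise \<beta> k \<in> J then of_nat (\<beta> k + 1) * G (raise \<beta> k) \<beta> else 0)
    = (\<Sum>\<alpha>\<in>J. of_nat (\<alpha> k) * G \<alpha> (\<alpha>(k := \<alpha> k - 1)))"
proof -
  have finJ: "finite J" using J finite_Lambda by (rule finite_subset)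
  have finF: "finite (flat m J)"
    by (rule finite_subset[OF _ finite_Lambda[of "m - 1"]]) (auto simp: flat_def)
  have lower_raise: "(raise \<beta> k)(k := raise \<beta> k k - 1) = \<beta>" for \<beta>
    by (auto simp: unitvec_def)
  have raise_k: "raise \<beta> k k = \<beta> k + 1" for \<beta> by (simp add: unitvec_def)
  have "(\<Sum>\<beta>\<in>flat m J. if raise \<beta> k \<in> J then of_nat (\<beta> k + 1) * G (raise \<beta> k) \<beta> else 0)
      = (\<Sum>\<beta>\<in>{\<beta>\<in>flat m J. raise \<beta> k \<in> J}. of_nat (\<beta> k + 1) * G (raise \<beta> k) \<beta>)"
    by (rule sum.inter_filter[OF finF, symmetric])
  also have "\<dots> = (\<Sum>\<alpha>\<in>{\<alpha>\<in>J. \<alpha> k \<noteq> 0}. of_nat (\<alpha> k) * G \<alpha> (\<alpha>(k := \<alpha> k - 1)))"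
  proof (rule sum.reindex_bij_witness[of _ "\<lambda>\<alpha>. \<alpha>(k := \<alpha> k - 1)" "\<lambda>\<beta>. raise \<beta> k"], goal_cases)
    case (4 \<alpha>)
    then have "deg (\<alpha>(k := \<alpha> k - 1)) = m - 1"
      using deg_upd[of \<alpha> k "\<alpha> k - 1"] J by (auto simp: Lambda_def)
    moreover have "raise (\<alpha>(k := \<alpha> k - 1)) k = \<alpha>" using 4 by (auto simp: unitvec_def)
    then have "raise (\<alpha>(k := \<alpha> k - 1)) k \<in> J" using 4 by (simp only: mem_Collect_eq)
    ultimately show ?case unfolding flat_def Lambda_def by blast
  next
    case (5 \<beta>)
    show ?case by (simp only: lower_raise) (simp only: raise_k)
  qed (auto simp: unitvec_def fun_eq_iff)
  also have "\<dots> = (\<Sum>\<alpha>\<in>J. of_nat (\<alpha> k) * G \<alpha> (\<alpha>(k := \<alpha> k - 1)))"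
    by (intro sum.mono_neutral_left finJ) auto
  finally show ?thesis .
qed

lemma mpow_raise: "mpow z (raise \<beta> k) = z k * mpow z \<beta>"
proof -
  have "mpow z (raise \<beta> k) = mpow z \<beta> * (\<Prod>i\<in>UNIV. if i = k then z i else 1)"
    unfolding mpow_def prod.distrib[symmetric] by (intro prod.cong) (auto simp: unitvec_def)
  then show ?thesis by (simp add: mult.commute)
qed

context lattice_norm
begin

text \<open>Coefficients of \<open>P h\<close> are extracted by a mean over the torus through
  \<open>x\<close>. This makes the functionals linear and bounded, and summing them against
  \<open>mpow w\<close> gives back the value of \<open>P h\<close> at the point \<open>x * w\<close>
  of the ball.\<close>

lemma projection_coefficient_functionals:
  assumes fin: "finite I" and lt: "\<And>\<beta> i. \<beta> \<in> I \<Longrightarrow> \<beta> i < M" and M: "0 < M"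
    and P: "is_projection_onto N I P"
    and PK: "\<And>f. f \<in> linf_ball N \<Longrightarrow> supnorm N (P f) \<le> K * supnorm N f"
    and x: "x \<in> unit_ball N"
  obtains \<psi> :: "('n \<Rightarrow> nat) \<Rightarrow> (('n \<Rightarrow> complex) \<Rightarrow> complex) \<Rightarrow> complex" where
    "\<And>\<beta>. linf_linear (\<psi> \<beta>)"
    "\<And>\<beta> h. \<beta> \<in> I \<Longrightarrow> h \<in> linf_ball N \<Longrightarrow> cmod (\<psi> \<beta> h) \<le> K * supnorm N h"
    "\<And>w h. w \<in> torus M \<Longrightarrow> h \<in> linf_ball N \<Longrightarrow> cmod (\<Sum>\<beta>\<in>I. \<psi> \<beta> h * mpow w \<beta>) \<le> K * supnorm N h"
    "\<And>\<beta>. \<beta> \<in> I \<Longrightarrow> \<psi> \<beta> (restr (\<lambda>z. mpow z \<beta>)) = mpow x \<beta>"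
proof -
  define xw where "xw = (\<lambda>w i. x i * w i :: complex)"
  define \<psi> where "\<psi> = (\<lambda>\<beta> h. tmean M (\<lambda>w. P h (xw w) * cnj (mpow w \<beta>)))"
  have xwB: "xw w \<in> unit_ball N" if "w \<in> torus M" for w
    unfolding xw_def by (rule ball_torus_mult[OF M x that])
  have Padd: "P (\<lambda>z. f z + g z) = (\<lambda>z. P f z + P g z)" if "f \<in> linf_ball N" "g \<in> linf_ball N" for f g
    using P that unfolding is_projection_onto_def by blast
  have Pscale: "P (\<lambda>z. a * f z) = (\<lambda>z. a * P f z)" if "f \<in> linf_ball N" for f a
    using P that unfolding is_projection_onto_def by blast
  have Pid: "P f = f" if "f \<in> polyfuns N I" for f
    using P that unfolding is_projection_onto_def by blast
  have Prange: "\<exists>c. P h = restr (mpoly_eval I c)" if "h \<in> linf_ball N" for h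
    using P that polyfuns_iff unfolding is_projection_onto_def by blast
  have Pbound: "cmod (P h (xw w)) \<le> K * supnorm N h" if h: "h \<in> linf_ball N" and w: "w \<in> torus M" for h w
  proof -
    have "P h \<in> linf_ball N" using Prange[OF h] restr_mpoly_eval_linf by auto
    from order.trans[OF linf_le_supnorm[OF this xwB[OF w]] PK[OF h]] show ?thesis .
  qed
  show ?thesis
  proof (rule that[of \<psi>])
    show "linf_linear (\<psi> \<beta>)" for \<beta>
      unfolding linf_linear_def \<psi>_def
      by (simp add: Padd Pscale distrib_right mult.assoc tmean_add tmean_cmult)
    show "cmod (\<psi> \<beta> h) \<le> K * supnorm N h" if "\<beta> \<in> I" "h \<in> linf_ball N" for \<beta> h
      unfolding \<psi>_def
    proof (rule order.trans[OF norm_tmean_le], rule tmean_le[OF M])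
      fix w :: "'n \<Rightarrow> complex" assume w: "w \<in> torus M"
      show "cmod (P h (xw w) * cnj (mpow w \<beta>)) \<le> K * supnorm N h"
        using Pbound[OF that(2) w] norm_mpow_torus[OF M w, of \<beta>] by (simp add: norm_mult)
    qed
    show "cmod (\<Sum>\<beta>\<in>I. \<psi> \<beta> h * mpow w \<beta>) \<le> K * supnorm N h" if w: "w \<in> torus M" and h: "h \<in> linf_ball N" for w h
    proof -
      obtain c where c: "P h = restr (mpoly_eval I c)" using Prange[OF h] by blast
      have ev: "P h (xw w) = mpoly_eval I (\<lambda>\<beta>. c \<beta> * mpow x \<beta>) w" if "w \<in> torus M" for w
        using xwB[OF that] unfolding c restr_def
        by (simp add: mpoly_eval_mpow xw_def mpow_mult mult.assoc)
      have "\<psi> \<beta> h = c \<beta> * mpow x \<beta>" if "\<beta> \<in> I" for \<beta>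
      proof -
        have "\<psi> \<beta> h = tmean M (\<lambda>w. mpoly_eval I (\<lambda>\<beta>. c \<beta> * mpow x \<beta>) w * cnj (mpow w \<beta>))"
          unfolding \<psi>_def by (rule tmean_cong) (simp add: ev)
        also have "\<dots> = c \<beta> * mpow x \<beta>" by (rule tmean_coeff) (use fin lt that in auto)
        finally show ?thesis .
      qed
      then have "(\<Sum>\<beta>\<in>I. \<psi> \<beta> h * mpow w \<beta>) = P h (xw w)"
        unfolding ev[OF w] mpoly_eval_mpow by simp
      then show ?thesis using Pbound[OF h w] by simp
    qed
    show "\<psi> \<beta> (restr (\<lambda>z. mpow z \<beta>)) = mpow x \<beta>" if \<beta>: "\<beta> \<in> I" for \<beta>
    proof -
      have "\<psi> \<beta> (restr (\<lambda>z. mpow z \<beta>)) = tmean M (\<lambda>w. mpow x \<beta> * (mpow w \<beta> * cnj (mpow w \<beta>)))"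
        unfolding \<psi>_def Pid[OF restr_mpow_polyfun[OF fin \<beta>]]
        by (rule tmean_cong) (simp add: restr_def xwB, simp add: xw_def mpow_mult mult.assoc)
      then show ?thesis using tmean_orthogonal[of \<beta> M \<beta>] lt[OF \<beta>] by (simp only: tmean_cmult) simp
    qed
  qed
qed

text \<open>By Euler's identity the left side is \<open>1 / m\<close> times the radial derivative,
  at the point of moduli, of the polynomial with coefficients \<open>cmod (c \<alpha>)\<close>.
  Sorted by exponents in \<open>flat m J\<close> it becomes a sum of terms
  \<open>b \<beta> * \<psi> \<beta> (z^\<beta>)\<close>, to which the diagonal bound
  applies.\<close>

lemma sum_abs_coeffs_le:
  assumes m: "1 \<le> m" and J: "J \<subseteq> Lambda m" and K: "0 \<le> K"
    and P: "is_projection_onto N (flat m J) P"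
    and PK: "\<And>f. f \<in> linf_ball N \<Longrightarrow> supnorm N (P f) \<le> K * supnorm N f"
    and y: "y \<in> unit_ball N"
  shows "(\<Sum>\<alpha>\<in>J. cmod (c \<alpha>) * cmod (mpow y \<alpha>)) \<le> exp 1 * 2 ^ m * K * psup N J c"
proof -
  define I where "I = flat m J"
  define d where "d = m - 1"
  have Il: "I \<subseteq> Lambda d" by (auto simp: I_def d_def flat_def)
  have finI: "finite I" using Il finite_Lambda by (rule finite_subset)
  obtain M where dM: "d < M" and
    M2: "(1 + 2 * pi * real d * real (d + 1) / real M) ^ (2 * CARD('n)) \<le> 2"
    using exists_hypercontractive_order by blast
  have M: "0 < M" using dM by simp
  have lt: "\<beta> i < M" if "\<beta> \<in> I" for \<beta> i
  proof -
    have "deg \<beta> = d" using Il that by (auto simp: Lambda_def)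
    then show ?thesis using le_deg[of \<beta> i] dM by simp
  qed
  define C where "C = sqrt 2 ^ d * (1 + 2 * pi * real d * real (d + 1) / real M) ^ CARD('n)"
  have C0: "0 \<le> C" by (simp add: C_def)
  \<comment> \<open>Each factor contributes \<open>sqrt 2 ^ (m - 1)\<close>; the remaining factor 2
    pays for the discretization of the torus.\<close>
  have C2: "C * C \<le> 2 ^ m"
  proof -
    have "C * C = (sqrt 2 * sqrt 2) ^ d * (1 + 2 * pi * real d * real (d + 1) / real M) ^ (2 * CARD('n))"
      unfolding C_def mult_2 power_add power_mult_distrib by (simp only: mult_ac)
    also have "\<dots> \<le> 2 ^ d * 2" using M2 by simp
    also have "\<dots> = 2 ^ m" using m by (cases m) (auto simp: d_def)
    finally show ?thesis .
  qed
  have hyp: "L2_set (\<lambda>\<beta>. cmod (a \<beta>)) I \<le> C * tmean M (\<lambda>w. cmod (mpoly_eval I a w))" for a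
    unfolding C_def by (rule hypercontractive_homogeneous[OF Il dM])
  \<comment> \<open>Solidity permits replacing \<open>y\<close> by its moduli, at which all
    monomials are nonnegative.\<close>
  define x where "x = (\<lambda>k. complex_of_real (cmod (y k)))"
  have x: "x \<in> unit_ball N" by (rule ball_solid[OF y]) (simp add: x_def)
  have mx: "mpow x \<alpha> = of_real (cmod (mpow y \<alpha>))" for \<alpha>
    unfolding norm_mpow by (simp add: mpow_def x_def)
  obtain \<psi> where \<psi>: "\<And>\<beta>. linf_linear (\<psi> \<beta>)"
    "\<And>\<beta> h. \<beta> \<in> I \<Longrightarrow> h \<in> linf_ball N \<Longrightarrow> cmod (\<psi> \<beta> h) \<le> K * supnorm N h"
    "\<And>w h. w \<in> torus M \<Longrightarrow> h \<in> linf_ball N \<Longrightarrow> cmod (\<Sum>\<beta>\<in>I. \<psi> \<beta> h * mpow w \<beta>) \<le> K * supnorm N h"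
    "\<And>\<beta>. \<beta> \<in> I \<Longrightarrow> \<psi> \<beta> (restr (\<lambda>z. mpow z \<beta>)) = mpow x \<beta>"
    by (rule projection_coefficient_functionals[OF finI _ M P[folded I_def] PK x]) (use lt in blast)+
  \<comment> \<open>The coefficients of the \<open>k\<close>-th partial derivative.\<close>
  define g where "g = (\<lambda>k \<beta>. if raise \<beta> k \<in> J then of_nat (\<beta> k + 1) * c (raise \<beta> k) else 0)"
  \<comment> \<open>The conjugate phases turn \<open>c\<close> into its modulus; the weights
    \<open>x k / m\<close> come from Euler's identity.\<close>
  define b where "b = (\<lambda>\<beta>. \<Sum>k\<in>UNIV. x k / of_nat m * (cnj (sgn (c (raise \<beta> k))) * g k \<beta>))"
  have dg: "mpoly_eval I (\<lambda>\<beta>. g k \<beta> * mpow z \<beta>) w = mpderiv J c k (\<lambda>i. z i * w i)" for k z w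
  proof -
    have "mpoly_eval I (\<lambda>\<beta>. g k \<beta> * mpow z \<beta>) w
       = (\<Sum>\<beta>\<in>flat m J. if raise \<beta> k \<in> J then of_nat (\<beta> k + 1) * (c (raise \<beta> k) * mpow (\<lambda>i. z i * w i) \<beta>) else 0)"
      unfolding mpoly_eval_mpow I_def mpow_mult by (intro sum.cong refl) (auto simp: g_def mult_ac)
    also have "\<dots> = mpderiv J c k (\<lambda>i. z i * w i)"
      unfolding sum_flat[OF J m, of k "\<lambda>\<alpha> \<beta>. c \<alpha> * mpow (\<lambda>i. z i * w i) \<beta>"] mpderiv_def
      by (simp add: mult_ac)
    finally show ?thesis .
  qed
  \<comment> \<open>The phases depend on \<open>k\<close> and \<open>\<beta>\<close> but are
    discarded by taking moduli inside the square function. Minkowski in \<open>k\<close> and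
    hypercontractivity of each partial derivative then leave a mean of weighted gradients, bounded
    pointwise.\<close>
  have bL: "L2_set (\<lambda>\<beta>. cmod (b \<beta> * mpow z \<beta>)) I \<le> C * (exp 1 * psup N J c)" if z: "z \<in> unit_ball N" for z
  proof -
    have "L2_set (\<lambda>\<beta>. cmod (b \<beta> * mpow z \<beta>)) I
        \<le> L2_set (\<lambda>\<beta>. \<Sum>k\<in>UNIV. cmod (y k) / real m * cmod (g k \<beta> * mpow z \<beta>)) I"
    proof (intro L2_set_mono)
      fix \<beta>
      have "cmod (b \<beta> * mpow z \<beta>) \<le> (\<Sum>k\<in>UNIV. cmod (x k / of_nat m * (cnj (sgn (c (raise \<beta> k))) * g k \<beta>) * mpow z \<beta>))"
        unfolding b_def sum_distrib_right by (rule norm_sum)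
      also have "\<dots> \<le> (\<Sum>k\<in>UNIV. cmod (y k) / real m * cmod (g k \<beta> * mpow z \<beta>))"
      proof (intro sum_mono)
        fix k
        have "cmod (cnj (sgn (c (raise \<beta> k)))) \<le> 1" by (simp add: norm_sgn)
        then have "cmod (cnj (sgn (c (raise \<beta> k)))) * (cmod (y k) / real m * cmod (g k \<beta> * mpow z \<beta>))
            \<le> 1 * (cmod (y k) / real m * cmod (g k \<beta> * mpow z \<beta>))"
          by (intro mult_right_mono) auto
        then show "cmod (x k / of_nat m * (cnj (sgn (c (raise \<beta> k))) * g k \<beta>) * mpow z \<beta>)
            \<le> cmod (y k) / real m * cmod (g k \<beta> * mpow z \<beta>)"
          by (simp add: norm_mult norm_divide x_def mult_ac)
      qed
      finally show "cmod (b \<beta> * mpow z \<beta>) \<le> (\<Sum>k\<in>UNIV. cmod (y k) / real m * cmod (g k \<beta> * mpow z \<beta>))" .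
    qed auto
    also have "\<dots> \<le> (\<Sum>k\<in>UNIV. L2_set (\<lambda>\<beta>. cmod (y k) / real m * cmod (g k \<beta> * mpow z \<beta>)) I)"
      by (rule L2_set_sum_le)
    also have "\<dots> = (\<Sum>k\<in>UNIV. cmod (y k) / real m * L2_set (\<lambda>\<beta>. cmod (g k \<beta> * mpow z \<beta>)) I)"
      by (intro sum.cong refl L2_set_right_distrib[symmetric]) simp
    also have "\<dots> \<le> (\<Sum>k\<in>UNIV. cmod (y k) / real m * (C * tmean M (\<lambda>w. cmod (mpderiv J c k (\<lambda>i. z i * w i)))))"
    proof (intro sum_mono mult_left_mono)
      fix k
      show "L2_set (\<lambda>\<beta>. cmod (g k \<beta> * mpow z \<beta>)) I \<le> C * tmean M (\<lambda>w. cmod (mpderiv J c k (\<lambda>i. z i * w i)))"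
        using hyp[of "\<lambda>\<beta>. g k \<beta> * mpow z \<beta>"] unfolding dg .
    qed auto
    also have "\<dots> = C / real m * tmean M (\<lambda>w. \<Sum>k\<in>UNIV. cmod (y k) * cmod (mpderiv J c k (\<lambda>i. z i * w i)))"
      unfolding tmean_sum tmean_cmult sum_distrib_left by (intro sum.cong refl) simp
    also have "\<dots> \<le> C / real m * (exp 1 * real m * psup N J c)"
      using C0 by (intro mult_left_mono tmean_le M gradient_bound m J y ball_torus_mult[OF M] z) auto
    also have "\<dots> = C * (exp 1 * psup N J c)" using m by simp
    finally show ?thesis .
  qed
  have "of_real (\<Sum>\<alpha>\<in>J. cmod (c \<alpha>) * cmod (mpow y \<alpha>)) = (\<Sum>\<beta>\<in>I. b \<beta> * mpow x \<beta>)"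
  proof -
    define a where "a = (\<lambda>\<alpha>. complex_of_real (cmod (c \<alpha>)) * mpow x \<alpha>)"
    have "(\<Sum>\<beta>\<in>I. b \<beta> * mpow x \<beta>)
        = (\<Sum>\<beta>\<in>I. \<Sum>k\<in>UNIV. 1 / of_nat m * (if raise \<beta> k \<in> J then of_nat (\<beta> k + 1) * a (raise \<beta> k) else 0))"
    proof (intro sum.cong refl)
      fix \<beta>
      have "x k / of_nat m * (cnj (sgn (c (raise \<beta> k))) * g k \<beta>) * mpow x \<beta>
          = 1 / of_nat m * (if raise \<beta> k \<in> J then of_nat (\<beta> k + 1) * a (raise \<beta> k) else 0)" for k
      proof (cases "raise \<beta> k \<in> J")
        case True
        have "x k / of_nat m * (cnj (sgn (c (raise \<beta> k))) * g k \<beta>) * mpow x \<beta>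
            = 1 / of_nat m * (of_nat (\<beta> k + 1) * ((cnj (sgn (c (raise \<beta> k))) * c (raise \<beta> k)) * (x k * mpow x \<beta>)))"
          using True by (simp add: g_def)
        then show ?thesis unfolding cnj_sgn_mult mpow_raise[symmetric] a_def using True by simp
      qed (simp add: g_def)
      then show "b \<beta> * mpow x \<beta> = (\<Sum>k\<in>UNIV. 1 / of_nat m * (if raise \<beta> k \<in> J then of_nat (\<beta> k + 1) * a (raise \<beta> k) else 0))"
        unfolding b_def sum_distrib_right by (intro sum.cong refl)
    qed
    also have "\<dots> = 1 / of_nat m * (\<Sum>k\<in>UNIV. \<Sum>\<beta>\<in>flat m J. if raise \<beta> k \<in> J then of_nat (\<beta> k + 1) * a (raise \<beta> k) else 0)"
      unfolding I_def sum_distrib_left by (rule sum.swap)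
    also have "\<dots> = 1 / of_nat m * (\<Sum>k\<in>UNIV. \<Sum>\<alpha>\<in>J. of_nat (\<alpha> k) * a \<alpha>)"
      using sum_flat[OF J m, of _ "\<lambda>\<alpha> \<beta>. a \<alpha>"] by simp
    \<comment> \<open>Euler's identity: the exponents \<open>\<alpha> k\<close> add up to the degree
      \<open>m\<close>.\<close>
    also have "\<dots> = 1 / of_nat m * (\<Sum>\<alpha>\<in>J. of_nat (deg \<alpha>) * a \<alpha>)"
      by (subst sum.swap) (simp add: deg_def sum_distrib_right)
    also have "\<dots> = 1 / of_nat m * (\<Sum>\<alpha>\<in>J. of_nat m * a \<alpha>)"
    proof -
      have "deg \<alpha> = m" if "\<alpha> \<in> J" for \<alpha> using J that by (auto simp: Lambda_def)
      then show ?thesis by simp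
    qed
    also have "\<dots> = (\<Sum>\<alpha>\<in>J. a \<alpha>)" using m by (simp add: sum_distrib_left[symmetric])
    also have "\<dots> = of_real (\<Sum>\<alpha>\<in>J. cmod (c \<alpha>) * cmod (mpow y \<alpha>))" by (simp add: a_def mx)
    finally show ?thesis by simp
  qed
  also have "\<dots> = (\<Sum>\<beta>\<in>I. b \<beta> * \<psi> \<beta> (restr (\<lambda>z. mpow z \<beta>)))" using \<psi>(4) by simp
  finally have "cmod (of_real (\<Sum>\<alpha>\<in>J. cmod (c \<alpha>) * cmod (mpow y \<alpha>)))
      = cmod (\<Sum>\<beta>\<in>I. b \<beta> * \<psi> \<beta> (restr (\<lambda>z. mpow z \<beta>)))" by (rule arg_cong)
  also have "\<dots> \<le> C * (exp 1 * psup N J c) * C * K"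
    by (rule diagonal_functional_bound[OF finI M K C0 \<psi>(1,2,3) hyp bL])
  also have "\<dots> = (C * C) * (exp 1 * psup N J c * K)" by simp
  also have "\<dots> \<le> 2 ^ m * (exp 1 * psup N J c * K)"
    using K psup_nonneg[of J c] by (intro mult_right_mono C2) auto
  finally have "cmod (of_real (\<Sum>\<alpha>\<in>J. cmod (c \<alpha>) * cmod (mpow y \<alpha>))) \<le> exp 1 * 2 ^ m * K * psup N J c"
    by (simp only: mult_ac)
  moreover have "0 \<le> (\<Sum>\<alpha>\<in>J. cmod (c \<alpha>) * cmod (mpow y \<alpha>))" by (intro sum_nonneg) auto
  ultimately show ?thesis by (simp only: norm_of_real abs_of_nonneg)
qed

end

section \<open>Projection constants\<close>

context lattice_norm
begin

text \<open>The admissible constants in \<open>proj_const\<close>. Estimates are proved for each of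
  them and carried to the infimum, so that attainment is never at issue.\<close>

definition proj_bound :: "('n \<Rightarrow> nat) set \<Rightarrow> real \<Rightarrow> bool" where
  "proj_bound I K \<longleftrightarrow> 0 \<le> K \<and> (\<exists>P. is_projection_onto N I P \<and>
     (\<forall>f\<in>linf_ball N. supnorm N (P f) \<le> K * supnorm N f))"

lemma proj_const_eq: "proj_const N I = Inf {K. proj_bound I K}"
  by (simp add: proj_const_def proj_bound_def)

text \<open>Needed because the infimum of an empty set would carry no information. A projection is
  built by reading off each coefficient as a mean over a torus of radius \<open>r\<close> inside the
  ball.\<close>

lemma exists_proj_bound:
  assumes fin: "finite I"
  shows "\<exists>K. proj_bound I K"
proof -
  obtain M where M: "0 < M" and lt: "\<And>\<beta> i. \<beta> \<in> I \<Longrightarrow> \<beta> i < M"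
    using exponents_less[OF fin] by blast
  obtain r where r: "0 < r" "(\<lambda>_. complex_of_real r) \<in> unit_ball N"
    using ball_contains_constant by blast
  have "\<forall>\<beta>. \<exists>R. 0 \<le> R \<and> (\<forall>z\<in>unit_ball N. cmod (mpow z \<beta>) \<le> R)" using bounded_mpow by metis
  then obtain R where R: "\<And>\<beta>. 0 \<le> R \<beta>" "\<And>\<beta> z. z \<in> unit_ball N \<Longrightarrow> cmod (mpow z \<beta>) \<le> R \<beta>" by metis
  define rw where "rw = (\<lambda>w (i::'n). complex_of_real r * w i :: complex)"
  have rwB: "rw w \<in> unit_ball N" if "w \<in> torus M" for w :: "'n \<Rightarrow> complex"
    unfolding rw_def by (rule ball_torus_mult[OF M r(2) that])
  define \<phi> where "\<phi> = (\<lambda>\<beta> f. 1 / of_real r ^ deg \<beta> * tmean M (\<lambda>w :: 'n \<Rightarrow> complex. f (rw w) * cnj (mpow w \<beta>)))"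
  define P where "P = (\<lambda>f. restr (mpoly_eval I (\<lambda>\<beta>. \<phi> \<beta> f)))"
  define K where "K = (\<Sum>\<beta>\<in>I. 1 / r ^ deg \<beta> * R \<beta>)"
  have "is_projection_onto N I P"
    unfolding is_projection_onto_def
  proof (intro conjI ballI allI)
    show "P f \<in> polyfuns N I" for f unfolding P_def polyfuns_iff by blast
    show "P (\<lambda>z. f z + g z) = (\<lambda>z. P f z + P g z)" for f g
      by (rule ext) (simp add: P_def restr_def mpoly_eval_mpow \<phi>_def tmean_add distrib_left distrib_right sum.distrib add_divide_distrib)
    show "P (\<lambda>z. a * f z) = (\<lambda>z. a * P f z)" for f a
      by (rule ext) (simp add: P_def restr_def mpoly_eval_mpow \<phi>_def mult.assoc tmean_cmult sum_distrib_left)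
    fix f assume "f \<in> polyfuns N I"
    then obtain c where c: "f = restr (mpoly_eval I c)" unfolding polyfuns_iff by blast
    have "\<phi> \<beta> f = c \<beta>" if \<beta>: "\<beta> \<in> I" for \<beta>
    proof -
      have "tmean M (\<lambda>w. f (rw w) * cnj (mpow w \<beta>))
          = tmean M (\<lambda>w. mpoly_eval I (\<lambda>\<beta>. c \<beta> * of_real r ^ deg \<beta>) w * cnj (mpow w \<beta>))"
        by (rule tmean_cong) (simp add: c restr_def rwB, simp add: rw_def mpoly_eval_mpow mpow_const_mult mult.assoc)
      also have "\<dots> = c \<beta> * of_real r ^ deg \<beta>"
        by (rule tmean_coeff) (use fin lt \<beta> in auto)
      finally show ?thesis using r(1) by (simp add: \<phi>_def)
    qed
    then show "P f = f" unfolding P_def c by (intro ext) (simp add: restr_def mpoly_eval_mpow)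
  qed
  moreover have "supnorm N (P f) \<le> K * supnorm N f" if f: "f \<in> linf_ball N" for f
  proof (rule supnorm_le)
    fix z assume z: "z \<in> unit_ball N"
    have \<phi>: "cmod (\<phi> \<beta> f) \<le> 1 / r ^ deg \<beta> * supnorm N f" for \<beta>
    proof -
      have "cmod (tmean M (\<lambda>w. f (rw w) * cnj (mpow w \<beta>))) \<le> supnorm N f"
      proof (rule order.trans[OF norm_tmean_le], rule tmean_le[OF M])
        fix w :: "'n \<Rightarrow> complex" assume w: "w \<in> torus M"
        show "cmod (f (rw w) * cnj (mpow w \<beta>)) \<le> supnorm N f"
          using linf_le_supnorm[OF f rwB[OF w]] norm_mpow_torus[OF M w, of \<beta>] by (simp add: norm_mult)
      qed
      then show ?thesis using r(1) by (simp add: \<phi>_def norm_mult norm_divide norm_power divide_right_mono)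
    qed
    have "cmod (P f z) \<le> (\<Sum>\<beta>\<in>I. cmod (\<phi> \<beta> f) * cmod (mpow z \<beta>))"
      using z norm_sum[of "\<lambda>\<beta>. \<phi> \<beta> f * mpow z \<beta>" I]
      by (simp add: P_def restr_def mpoly_eval_mpow norm_mult)
    also have "\<dots> \<le> (\<Sum>\<beta>\<in>I. (1 / r ^ deg \<beta> * supnorm N f) * R \<beta>)"
      by (intro sum_mono mult_mono \<phi> R z order.trans[OF norm_ge_zero \<phi>]) auto
    also have "\<dots> = K * supnorm N f" by (simp add: K_def sum_distrib_left sum_distrib_right mult_ac)
    finally show "cmod (P f z) \<le> K * supnorm N f" .
  qed
  moreover have "0 \<le> K" unfolding K_def using r(1) R(1) by (intro sum_nonneg) auto
  ultimately show ?thesis unfolding proj_bound_def by blast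
qed

lemma psup_single_pos:
  assumes "finite I" "\<beta> \<in> I"
  shows "0 < psup N I (\<lambda>\<gamma>. if \<gamma> = \<beta> then 1 else 0)"
proof -
  obtain r where r: "0 < r" "(\<lambda>_. complex_of_real r) \<in> unit_ball N"
    using ball_contains_constant by blast
  have "r ^ deg \<beta> \<le> psup N I (\<lambda>\<gamma>. if \<gamma> = \<beta> then 1 else 0)"
    using mpoly_eval_le_psup[OF r(2), of I "\<lambda>\<gamma>. if \<gamma> = \<beta> then 1 else 0"] r(1)
    by (simp only: mpoly_eval_single[OF assms] mpow_constant) (simp add: norm_power)
  then show ?thesis using r(1) by (auto intro: less_le_trans[rotated])
qed

text \<open>A projection fixes a monomial with exponent in \<open>I\<close>, whose norm is
  positive.\<close>

lemma proj_const_ge_1: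
  assumes fin: "finite I" and ne: "I \<noteq> {}"
  shows "1 \<le> proj_const N I"
  unfolding proj_const_eq
proof (rule cInf_greatest)
  show "{K. proj_bound I K} \<noteq> {}" using exists_proj_bound[OF fin] by simp
  fix K assume "K \<in> {K. proj_bound I K}"
  then obtain P where P: "is_projection_onto N I P" "\<forall>f\<in>linf_ball N. supnorm N (P f) \<le> K * supnorm N f"
    unfolding proj_bound_def by blast
  obtain \<beta> where \<beta>: "\<beta> \<in> I" using ne by blast
  define c where "c = (\<lambda>\<gamma>. if \<gamma> = \<beta> then 1 else 0 :: complex)"
  have "restr (mpoly_eval I c) \<in> polyfuns N I" unfolding polyfuns_iff by blast
  then have "P (restr (mpoly_eval I c)) = restr (mpoly_eval I c)"
    using P(1) unfolding is_projection_onto_def by blast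
  then have "psup N I c \<le> K * psup N I c"
    using P(2) restr_mpoly_eval_linf[of I c] supnorm_restr_mpoly_eval[of I c] by force
  moreover have "0 < psup N I c" unfolding c_def by (rule psup_single_pos[OF fin \<beta>])
  ultimately show "1 \<le> K" by simp
qed

lemma proj_const_nonneg:
  assumes "finite I"
  shows "0 \<le> proj_const N I"
  unfolding proj_const_eq
  by (rule cInf_greatest) (use exists_proj_bound[OF assms] in \<open>auto simp: proj_bound_def\<close>)

lemma coeff_le_psup:
  assumes r: "0 < r" "(\<lambda>_. complex_of_real r) \<in> unit_ball N" and fin: "finite A" and \<alpha>: "\<alpha> \<in> A"
  shows "cmod (c \<alpha>) * r ^ deg \<alpha> \<le> psup N A c"
proof -
  obtain M where M: "0 < M" and lt: "\<And>\<beta> i. \<beta> \<in> A \<Longrightarrow> \<beta> i < M"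
    using exponents_less[OF fin] by blast
  have "c \<alpha> * of_real r ^ deg \<alpha> = tmean M (\<lambda>w. mpoly_eval A (\<lambda>\<beta>. c \<beta> * of_real r ^ deg \<beta>) w * cnj (mpow w \<alpha>))"
    by (rule tmean_coeff[symmetric]) (use fin lt \<alpha> in auto)
  also have "cmod \<dots> \<le> psup N A c"
  proof (rule order.trans[OF norm_tmean_le], rule tmean_le[OF M])
    fix w :: "'n \<Rightarrow> complex" assume w: "w \<in> torus M"
    have "mpoly_eval A (\<lambda>\<beta>. c \<beta> * of_real r ^ deg \<beta>) w = mpoly_eval A c (\<lambda>i. of_real r * w i)"
      by (simp add: mpoly_eval_mpow mpow_const_mult mult.assoc)
    then show "cmod (mpoly_eval A (\<lambda>\<beta>. c \<beta> * of_real r ^ deg \<beta>) w * cnj (mpow w \<alpha>)) \<le> psup N A c"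
      using mpoly_eval_le_psup[OF ball_torus_mult[OF M r(2) w], of A c] norm_mpow_torus[OF M w, of \<alpha>]
      by (simp add: norm_mult)
  qed
  finally show ?thesis using r(1) by (simp add: norm_mult norm_power)
qed

text \<open>The coefficient projection fixes a monomial with exponent in \<open>I\<close>. That some
  finite constant is admissible is shown first, by bounding each coefficient by the norm.\<close>

lemma qnorm_ge_1:
  assumes fin: "finite A" and IA: "I \<subseteq> A" and ne: "I \<noteq> {}"
  shows "1 \<le> qnorm N A I"
  unfolding qnorm_def
proof (rule cInf_greatest)
  have finI: "finite I" using IA fin by (rule finite_subset)
  obtain r where r: "0 < r" "(\<lambda>_. complex_of_real r) \<in> unit_ball N"
    using ball_contains_constant by blast
  have "\<forall>\<beta>. \<exists>R. 0 \<le> R \<and> (\<forall>z\<in>unit_ball N. cmod (mpow z \<beta>) \<le> R)" using bounded_mpow by metis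
  then obtain R where R: "\<And>\<beta>. 0 \<le> R \<beta>" "\<And>\<beta> z. z \<in> unit_ball N \<Longrightarrow> cmod (mpow z \<beta>) \<le> R \<beta>" by metis
  define K where "K = (\<Sum>\<beta>\<in>I. 1 / r ^ deg \<beta> * R \<beta>)"
  have "psup N I c \<le> K * psup N A c" for c
  proof (rule psup_le)
    fix z assume z: "z \<in> unit_ball N"
    have c: "cmod (c \<beta>) \<le> 1 / r ^ deg \<beta> * psup N A c" if "\<beta> \<in> I" for \<beta>
      using coeff_le_psup[OF r fin, of \<beta> c] that IA r(1) by (auto simp: field_simps)
    have "cmod (mpoly_eval I c z) \<le> (\<Sum>\<beta>\<in>I. cmod (c \<beta>) * cmod (mpow z \<beta>))"
      unfolding mpoly_eval_mpow norm_mult[symmetric] by (rule norm_sum)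
    also have "\<dots> \<le> (\<Sum>\<beta>\<in>I. (1 / r ^ deg \<beta> * psup N A c) * R \<beta>)"
      by (intro sum_mono mult_mono c R z order.trans[OF norm_ge_zero c]) auto
    also have "\<dots> = K * psup N A c" by (simp add: K_def sum_distrib_left sum_distrib_right mult_ac)
    finally show "cmod (mpoly_eval I c z) \<le> K * psup N A c" .
  qed
  moreover have "0 \<le> K" unfolding K_def using r(1) R(1) by (intro sum_nonneg) auto
  ultimately show "{K. 0 \<le> K \<and> (\<forall>c. psup N I c \<le> K * psup N A c)} \<noteq> {}" by blast
  fix K' assume "K' \<in> {K. 0 \<le> K \<and> (\<forall>c. psup N I c \<le> K * psup N A c)}"
  then have K': "\<And>c. psup N I c \<le> K' * psup N A c" by blast
  obtain \<beta> where \<beta>: "\<beta> \<in> I" "\<beta> \<in> A" using ne IA by blast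
  define c where "c = (\<lambda>\<gamma>. if \<gamma> = \<beta> then 1 else 0 :: complex)"
  have "psup N I c = psup N A c"
    unfolding psup_def c_def mpoly_eval_single[OF finI \<beta>(1)] mpoly_eval_single[OF fin \<beta>(2)] ..
  moreover have "0 < psup N A c" unfolding c_def by (rule psup_single_pos[OF fin \<beta>(2)])
  ultimately show "1 \<le> K'" using K'[of c] by simp
qed

section \<open>Unconditionality constants\<close>

text \<open>The sum of the moduli of all terms does not see the signs. The bound holds for every
  admissible projection constant and passes to the infimum after division by the remaining factor
  \<open>E\<close>, the case \<open>E = 0\<close> being separate.\<close>

lemma unconditional_homogeneous:
  assumes m: "1 \<le> m" and J: "J \<subseteq> Lambda m" and \<epsilon>: "\<And>\<alpha>. cmod (\<epsilon> \<alpha>) = 1"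
  shows "psup N J (\<lambda>\<alpha>. \<epsilon> \<alpha> * c \<alpha>) \<le> exp 1 * 2 ^ m * proj_const N (flat m J) * psup N J c"
proof -
  have fin: "finite (flat m J)"
    by (rule finite_subset[OF _ finite_Lambda[of "m - 1"]]) (auto simp: flat_def)
  define E where "E = exp 1 * 2 ^ m * psup N J c"
  define X where "X = psup N J (\<lambda>\<alpha>. \<epsilon> \<alpha> * c \<alpha>)"
  have E0: "0 \<le> E" by (simp add: E_def psup_nonneg)
  have XK: "X \<le> E * K" if K: "proj_bound (flat m J) K" for K
    unfolding X_def
  proof (rule psup_le)
    fix y assume y: "y \<in> unit_ball N"
    obtain P where P: "0 \<le> K" "is_projection_onto N (flat m J) P" "\<And>f. f \<in> linf_ball N \<Longrightarrow> supnorm N (P f) \<le> K * supnorm N f"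
      using K unfolding proj_bound_def by blast
    have "cmod (mpoly_eval J (\<lambda>\<alpha>. \<epsilon> \<alpha> * c \<alpha>) y) \<le> (\<Sum>\<alpha>\<in>J. cmod (\<epsilon> \<alpha> * c \<alpha> * mpow y \<alpha>))"
      unfolding mpoly_eval_mpow by (rule norm_sum)
    also have "\<dots> = (\<Sum>\<alpha>\<in>J. cmod (c \<alpha>) * cmod (mpow y \<alpha>))" by (simp add: norm_mult \<epsilon>)
    also have "\<dots> \<le> exp 1 * 2 ^ m * K * psup N J c" by (rule sum_abs_coeffs_le[OF m J P y])
    finally show "cmod (mpoly_eval J (\<lambda>\<alpha>. \<epsilon> \<alpha> * c \<alpha>) y) \<le> E * K" by (simp add: E_def mult_ac)
  qed
  have "X \<le> E * proj_const N (flat m J)"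
  proof (cases "E = 0")
    case True
    then show ?thesis using XK exists_proj_bound[OF fin] by auto
  next
    case False
    then have E: "0 < E" using E0 by simp
    have "X / E \<le> proj_const N (flat m J)"
      unfolding proj_const_eq
    proof (rule cInf_greatest)
      show "{K. proj_bound (flat m J) K} \<noteq> {}" using exists_proj_bound[OF fin] by simp
      show "X / E \<le> K" if "K \<in> {K. proj_bound (flat m J) K}" for K
        using XK[of K] that E by (simp add: divide_le_eq mult.commute)
    qed
    then show ?thesis using E by (simp add: divide_le_eq mult.commute)
  qed
  then show ?thesis by (simp add: X_def E_def mult_ac)
qed

lemma chi_mon_le:
  assumes "0 \<le> C"
    and "\<And>c \<epsilon>. (\<And>\<alpha>. cmod (\<epsilon> \<alpha>) = 1) \<Longrightarrow> psup N J (\<lambda>\<alpha>. \<epsilon> \<alpha> * c \<alpha>) \<le> C * psup N J c"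
  shows "chi_mon N J \<le> C"
  unfolding chi_mon_def by (rule cInf_lower) (use assms in \<open>auto intro!: bdd_belowI[of _ 0]\<close>)

end

text \<open>The general bound follows by splitting into the homogeneous parts of degree 0 to
  \<open>m\<close>, which explains the factor \<open>m + 1\<close>. The assumption
  \<open>nontriv\<close> yields a degree at which both maxima are at least 1.\<close>

theorem theorem2p7:
  fixes N :: "('n::finite \<Rightarrow> complex) \<Rightarrow> real"
    and J :: "('n \<Rightarrow> nat) set"
    and m :: nat
  assumes lattice: "banach_lattice_norm N"
    and m_pos: "1 \<le> m"
    and degJ: "\<forall>\<alpha>\<in>J. deg \<alpha> \<le> m"
    and nontriv: "\<exists>\<alpha>\<in>J. 1 \<le> deg \<alpha>"
  shows "(chi_mon N J \<le> exp 1 * real (m + 1) * 2 ^ m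
           * (MAX k\<in>{1..m}. qnorm N (Lambda k) (J \<inter> Lambda k))
           * (MAX k\<in>{1..m}. proj_const N (flat k (J \<inter> Lambda k))))
       \<and> (J \<subseteq> Lambda m \<longrightarrow>
         chi_mon N J \<le> exp 1 * 2 ^ m * qnorm N (Lambda m) J * proj_const N (flat m J))"
proof (intro conjI impI)
  interpret lattice_norm N by unfold_locales (rule lattice)
  have finflat: "finite (flat k I)" for k and I :: "('n \<Rightarrow> nat) set"
    by (rule finite_subset[OF _ finite_Lambda[of "k - 1"]]) (auto simp: flat_def)
  define Q where "Q = (MAX k\<in>{1..m}. qnorm N (Lambda k) (J \<inter> Lambda k))"
  define L where "L = (MAX k\<in>{1..m}. proj_const N (flat k (J \<inter> Lambda k)))"
  have Lk: "proj_const N (flat k (J \<inter> Lambda k)) \<le> L" if "k \<in> {1..m}" for k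
    unfolding L_def using that by (intro Max_ge) auto
  obtain \<alpha> where \<alpha>: "\<alpha> \<in> J" "1 \<le> deg \<alpha>" using nontriv by blast
  define k0 where "k0 = deg \<alpha>"
  have k0: "k0 \<in> {1..m}" using \<alpha> degJ by (auto simp: k0_def)
  have "\<alpha> \<in> J \<inter> Lambda k0" using \<alpha> by (simp add: Lambda_def k0_def)
  then have "1 \<le> qnorm N (Lambda k0) (J \<inter> Lambda k0)"
    by (intro qnorm_ge_1 finite_Lambda) auto
  also have "\<dots> \<le> Q" unfolding Q_def using k0 by (intro Max_ge) auto
  finally have Q1: "1 \<le> Q" .
  \<comment> \<open>Lowering a nonzero coordinate of \<open>\<alpha>\<close> gives an element.
    Without one the space would be zero and its projection constant 0.\<close>
  have "flat k0 (J \<inter> Lambda k0) \<noteq> {}"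
  proof -
    have "\<exists>i. \<alpha> i \<noteq> 0" using \<alpha>(2) by (auto simp: deg_def intro: ccontr)
    then obtain i where "\<alpha> i \<noteq> 0" by blast
    then have "raise (\<alpha>(i := \<alpha> i - 1)) i = \<alpha>" by (auto simp: unitvec_def)
    moreover have "deg (\<alpha>(i := \<alpha> i - 1)) = k0 - 1"
      using deg_upd[of \<alpha> i "\<alpha> i - 1"] \<open>\<alpha> i \<noteq> 0\<close> by (simp add: k0_def)
    ultimately have "\<alpha>(i := \<alpha> i - 1) \<in> flat k0 (J \<inter> Lambda k0)"
      using \<open>\<alpha> \<in> J \<inter> Lambda k0\<close> unfolding flat_def Lambda_def
      by (intro CollectI conjI exI[of _ i]) (simp_all only: mem_Collect_eq)
    then show ?thesis by blast
  qed
  then have "1 \<le> proj_const N (flat k0 (J \<inter> Lambda k0))" by (intro proj_const_ge_1 finflat)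
  with Lk[OF k0] have L1: "1 \<le> L" by simp
  define D where "D = exp 1 * 2 ^ m * L"
  \<comment> \<open>Required for the constant term, on which a unimodular factor acts
    isometrically.\<close>
  have D1: "1 \<le> D"
  proof -
    have "1 * 1 * 1 \<le> exp 1 * 2 ^ m * L" using L1 by (intro mult_mono) auto
    then show ?thesis by (simp add: D_def)
  qed
  have "chi_mon N J \<le> real (m + 1) * D"
  proof (rule chi_mon_le)
    show "0 \<le> real (m + 1) * D" using D1 by simp
    fix c \<epsilon> :: "('n \<Rightarrow> nat) \<Rightarrow> complex" assume \<epsilon>: "\<And>\<alpha>. cmod (\<epsilon> \<alpha>) = 1"
    have part: "psup N (J \<inter> Lambda k) (\<lambda>\<alpha>. \<epsilon> \<alpha> * c \<alpha>) \<le> D * psup N J c" if k: "k \<le> m" for k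
    proof (cases "k = 0")
      case True
      have "J \<inter> Lambda 0 \<subseteq> {\<lambda>_. 0}" by (auto simp: Lambda_def deg_def)
      then consider "J \<inter> Lambda 0 = {}" | "J \<inter> Lambda 0 = {\<lambda>_. 0}" by blast
      then have "cmod (mpoly_eval (J \<inter> Lambda 0) (\<lambda>\<alpha>. \<epsilon> \<alpha> * c \<alpha>) z) = cmod (mpoly_eval (J \<inter> Lambda 0) c z)" for z
        by cases (simp_all add: mpoly_eval_def norm_mult \<epsilon>)
      then have "psup N (J \<inter> Lambda k) (\<lambda>\<alpha>. \<epsilon> \<alpha> * c \<alpha>) = psup N (J \<inter> Lambda k) c"
        unfolding psup_def True by simp
      also have "\<dots> \<le> psup N J c" by (rule psup_homogeneous_part_le[OF degJ k])
      also have "\<dots> \<le> D * psup N J c" using D1 psup_nonneg[of J c] by (simp add: mult_le_cancel_right1)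
      finally show ?thesis .
    next
      case False
      then have k1: "1 \<le> k" by simp
      have "psup N (J \<inter> Lambda k) (\<lambda>\<alpha>. \<epsilon> \<alpha> * c \<alpha>)
          \<le> exp 1 * 2 ^ k * proj_const N (flat k (J \<inter> Lambda k)) * psup N (J \<inter> Lambda k) c"
        by (rule unconditional_homogeneous[OF k1 _ \<epsilon>]) auto
      also have "\<dots> \<le> exp 1 * 2 ^ m * L * psup N J c"
        using k k1 L1
        by (intro mult_mono Lk psup_homogeneous_part_le[OF degJ k] psup_nonneg proj_const_nonneg finflat
            mult_nonneg_nonneg power_increasing) auto
      finally show ?thesis by (simp add: D_def)
    qed
    show "psup N J (\<lambda>\<alpha>. \<epsilon> \<alpha> * c \<alpha>) \<le> real (m + 1) * D * psup N J c"
    proof (rule psup_le)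
      fix z assume z: "z \<in> unit_ball N"
      have "cmod (mpoly_eval J (\<lambda>\<alpha>. \<epsilon> \<alpha> * c \<alpha>) z)
          \<le> (\<Sum>k\<le>m. cmod (mpoly_eval (J \<inter> Lambda k) (\<lambda>\<alpha>. \<epsilon> \<alpha> * c \<alpha>) z))"
        unfolding mpoly_eval_decompose[OF degJ] by (rule norm_sum)
      \<comment> \<open>All \<open>m + 1\<close> parts, including degree 0, obey the same
        bound.\<close>
      also have "\<dots> \<le> (\<Sum>k\<le>m. D * psup N J c)"
        by (intro sum_mono order.trans[OF mpoly_eval_le_psup[OF z] part]) auto
      finally show "cmod (mpoly_eval J (\<lambda>\<alpha>. \<epsilon> \<alpha> * c \<alpha>) z) \<le> real (m + 1) * D * psup N J c"
        by (simp add: mult.assoc)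
    qed
  qed
  also have "\<dots> \<le> real (m + 1) * D * Q"
    using mult_left_mono[OF Q1, of "real (m + 1) * D"] D1 by simp
  finally show "chi_mon N J \<le> exp 1 * real (m + 1) * 2 ^ m
           * (MAX k\<in>{1..m}. qnorm N (Lambda k) (J \<inter> Lambda k))
           * (MAX k\<in>{1..m}. proj_const N (flat k (J \<inter> Lambda k)))"
    unfolding Q_def[symmetric] L_def[symmetric] D_def by (simp only: mult_ac)
next
  interpret lattice_norm N by unfold_locales (rule lattice)
  assume J: "J \<subseteq> Lambda m"
  define L where "L = exp 1 * 2 ^ m * proj_const N (flat m J)"
  have "finite (flat m J)"
    by (rule finite_subset[OF _ finite_Lambda[of "m - 1"]]) (auto simp: flat_def)
  then have L0: "0 \<le> L" unfolding L_def by (simp add: proj_const_nonneg)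
  have Q1: "1 \<le> qnorm N (Lambda m) J" using J nontriv by (intro qnorm_ge_1 finite_Lambda) auto
  have "chi_mon N J \<le> L"
    unfolding L_def by (rule chi_mon_le) (use L0 in \<open>auto simp: L_def intro: unconditional_homogeneous[OF m_pos J]\<close>)
  also have "\<dots> = L * 1" by simp
  also have "\<dots> \<le> L * qnorm N (Lambda m) J" by (rule mult_left_mono[OF Q1 L0])
  finally show "chi_mon N J \<le> exp 1 * 2 ^ m * qnorm N (Lambda m) J * proj_const N (flat m J)"
    unfolding L_def by (simp only: mult_ac)
qed

end
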